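(* Let $k \geq 2$ be a constant integer, let $0 < q \leq \frac{1}{2}$, and let $g : \{0,\ldots,n-1\} \to \{0,\ldots,k-1\}$ be an unknown assignment of $n$ items to $k$ groups. Suppose we have access to a noisy oracle which, queried on a pair of items $(x,y)$, returns the random answer $$\tilde{f}(x,y) = \begin{cases} g(x)-g(y) \bmod k & \text{with probability } 1-q,\\ g(x)-g(y)+1 \bmod k & \text{with probability } q/2,\\ g(x)-g(y)-1 \bmod k & \text{with probability } q/2,\end{cases}$$ independently across queries, where each pair may be queried at most once. Then there exists a polynomial time algorithm that performs $O(n^{1+o(1)})$ queries and, with probability tending to $1$ as $n \to \infty$, recovers $g$ up to a global offset, i.e., outputs $\hat g$ such that $\hat g(i) = g(i) + c \bmod k$ for all items $i$ and some constant $c \in \{0,\ldots,k-1\}$.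
   Context: A global offset is unrecoverable, since the assignments $\{g(i)+c \bmod k\}_i$ for $c\in\{0,\ldots,k-1\}$ produce identical pairwise differences. Querying $(y,x)$ after $(x,y)$ gives no new information (it is the additive inverse modulo $k$).
   Formalization: The case k = 2, q = 1/2 is excluded: there both noisy answers coincide modulo 2, so every oracle answer is a fair coin independent of g, and no algorithm can recover g with probability tending to 1. *)

theory Defs
  imports "HOL-Probability.Probability" "HOL-Computational_Algebra.Polynomial"
    "HOL-Library.Landau_Symbols"
begin

definition shifted_diff :: "nat \<Rightarrow> (nat \<Rightarrow> nat) \<Rightarrow> nat \<Rightarrow> nat \<Rightarrow> int \<Rightarrow> nat" where
  "shifted_diff k g x y e = nat ((int (g x) - int (g y) + e) mod int k)"

text \<open>
  \<open>pmf_of_list\<close> adds up the weights of repeated values. For \<open>k = 2\<close> the two noisy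
  answers coincide, and that value then has probability \<open>q\<close>.
\<close>

definition answer_pmf :: "nat \<Rightarrow> real \<Rightarrow> (nat \<Rightarrow> nat) \<Rightarrow> nat \<Rightarrow> nat \<Rightarrow> nat pmf" where
  "answer_pmf k q g x y = pmf_of_list
     [(shifted_diff k g x y 0, 1 - q),
      (shifted_diff k g x y 1, q / 2),
      (shifted_diff k g x y (-1), q / 2)]"

lemma pmf_of_list_wf_answer:
  fixes q :: real
  assumes "0 \<le> q" "q \<le> 1"
  shows "pmf_of_list_wf [(a, 1 - q), (b, q / 2), (c, q / 2)]"
  using assms by (auto simp: pmf_of_list_wf_def)

lemma pmf_answer_pmf:
  assumes "0 \<le> q" "q \<le> 1"
  shows "pmf (answer_pmf k q g x y) a =
    (if a = shifted_diff k g x y 0 then 1 - q else 0) +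
    (if a = shifted_diff k g x y 1 then q / 2 else 0) +
    (if a = shifted_diff k g x y (-1) then q / 2 else 0)"
  unfolding answer_pmf_def
  by (subst pmf_pmf_of_list[OF pmf_of_list_wf_answer[OF assms]]) auto

text \<open>
  For \<open>k = 2\<close> and \<open>q = 1/2\<close> every answer is a fair coin that is independent of the hidden
  assignment, so nothing can be recovered.
\<close>

lemma answer_pmf_two_half: "answer_pmf 2 (1/2) g x y = answer_pmf 2 (1/2) g' x' y'"
proof (rule pmf_eqI)
  fix a
  have parity: "d mod 2 = 0 \<Longrightarrow> (d + 1) mod 2 = 1 \<and> (d + -1) mod 2 = 1"
      "d mod 2 = 1 \<Longrightarrow> (d + 1) mod 2 = 0 \<and> (d + -1) mod 2 = 0" for d :: int
    by presburger+
  have *: "pmf (answer_pmf 2 (1/2) h u v) a = (if a = 0 \<or> a = 1 then 1/2 else 0)" for h u v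
  proof -
    define d where "d = int (h u) - int (h v)"
    have shift: "shifted_diff 2 h u v e = nat ((d + e) mod 2)" for e
      by (simp add: shifted_diff_def d_def)
    consider "d mod 2 = 0" | "d mod 2 = 1" by linarith
    thus ?thesis
    proof cases
      case 1
      thus ?thesis using parity(1)[OF 1] unfolding pmf_answer_pmf[of "1/2", simplified] shift
        by (simp only:) simp
    next
      case 2
      thus ?thesis using parity(2)[OF 2] unfolding pmf_answer_pmf[of "1/2", simplified] shift
        by (simp only:) simp
    qed
  qed
  show "pmf (answer_pmf 2 (1/2) g x y) a = pmf (answer_pmf 2 (1/2) g' x' y') a"
    unfolding * ..
qed

text \<open>
  All answers are drawn independently in advance, one for each ordered pair of items. An
  algorithm that never repeats a pair, in either order, thus sees a fresh independent sample at
  every query.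
\<close>

definition oracle_pmf :: "nat \<Rightarrow> real \<Rightarrow> nat \<Rightarrow> (nat \<Rightarrow> nat) \<Rightarrow> (nat \<times> nat \<Rightarrow> nat) pmf" where
  "oracle_pmf k q n g = Pi_pmf ({..<n} \<times> {..<n}) 0 (\<lambda>(x, y). answer_pmf k q g x y)"

text \<open>
  Programs for a random access machine with a fixed number of registers (those named in the
  program), an unbounded memory, an oracle and a source of fair coins. Every instruction and every
  evaluation of a guard costs one time unit. As the only arithmetic is addition and truncated
  subtraction, numbers grow by at most one bit per step, so that polynomial time here is polynomial
  time on a Turing machine. Multiplication at unit cost would break this.
\<close>

datatype instr =
    Const nat nat
  | Add nat nat nat
  | Sub nat nat nat
  | Load nat nat
  | Store nat nat
  | Query nat nat nat
  | Flip nat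

datatype com =
    Do instr
  | Seq com com
  | Cond nat com com
  | While nat com

record state =
  reg :: "nat \<Rightarrow> nat"
  mem :: "nat \<Rightarrow> nat"
  asked :: "(nat \<times> nat) list"
  flips :: nat

fun instr_step :: "(nat \<times> nat \<Rightarrow> nat) \<Rightarrow> (nat \<Rightarrow> bool) \<Rightarrow> instr \<Rightarrow> state \<Rightarrow> state" where
  "instr_step f w (Const r c) s = s\<lparr>reg := (reg s)(r := c)\<rparr>"
| "instr_step f w (Add r a b) s = s\<lparr>reg := (reg s)(r := reg s a + reg s b)\<rparr>"
| "instr_step f w (Sub r a b) s = s\<lparr>reg := (reg s)(r := reg s a - reg s b)\<rparr>"
| "instr_step f w (Load r a) s = s\<lparr>reg := (reg s)(r := mem s (reg s a))\<rparr>"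
| "instr_step f w (Store a r) s = s\<lparr>mem := (mem s)(reg s a := reg s r)\<rparr>"
| "instr_step f w (Query r a b) s =
     s\<lparr>reg := (reg s)(r := f (reg s a, reg s b)), asked := (reg s a, reg s b) # asked s\<rparr>"
| "instr_step f w (Flip r) s =
     s\<lparr>reg := (reg s)(r := of_bool (w (flips s))), flips := Suc (flips s)\<rparr>"

text \<open>
  \<open>exec f w P s t s'\<close>: with oracle answers \<open>f\<close> and coin flips \<open>w\<close>, the program \<open>P\<close> started in
  \<open>s\<close> halts in \<open>s'\<close> after exactly \<open>t\<close> time units.
\<close>

inductive exec ::
  "(nat \<times> nat \<Rightarrow> nat) \<Rightarrow> (nat \<Rightarrow> bool) \<Rightarrow> com \<Rightarrow> state \<Rightarrow> nat \<Rightarrow> state \<Rightarrow> bool"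
  for f w where
  Do: "exec f w (Do i) s 1 (instr_step f w i s)"
| Seq: "exec f w P s t s' \<Longrightarrow> exec f w P' s' t' s'' \<Longrightarrow> exec f w (Seq P P') s (t + t') s''"
| Cond_true: "reg s r \<noteq> 0 \<Longrightarrow> exec f w P s t s' \<Longrightarrow> exec f w (Cond r P P') s (Suc t) s'"
| Cond_false: "reg s r = 0 \<Longrightarrow> exec f w P' s t s' \<Longrightarrow> exec f w (Cond r P P') s (Suc t) s'"
| While_true: "reg s r \<noteq> 0 \<Longrightarrow> exec f w P s t s' \<Longrightarrow> exec f w (While r P) s' t' s'' \<Longrightarrow>
    exec f w (While r P) s (Suc (t + t')) s''"
| While_false: "reg s r = 0 \<Longrightarrow> exec f w (While r P) s 1 s"

inductive_cases exec_DoE: "exec f w (Do i) s t s'"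
inductive_cases exec_SeqE: "exec f w (Seq P P') s t s'"
inductive_cases exec_CondE: "exec f w (Cond r P P') s t s'"
inductive_cases exec_WhileE: "exec f w (While r P) s t s'"

lemma exec_deterministic:
  assumes "exec f w P s t s'" "exec f w P s u s''"
  shows "u = t \<and> s'' = s'"
  using assms
proof (induction arbitrary: u s'' rule: exec.induct)
  case (Do i s)
  thus ?case by (auto elim: exec_DoE)
next
  case (Seq P s t s' P' t' s3)
  from Seq.prems obtain v v' s4 where
    *: "exec f w P s v s4" "exec f w P' s4 v' s''" "u = v + v'"
    by (rule exec_SeqE)
  show ?case using Seq.IH(1)[OF *(1)] Seq.IH(2) *(2,3) by auto
next
  case (Cond_true s r P t s' P')
  from Cond_true.prems Cond_true.hyps(1) Cond_true.IH show ?case by (cases rule: exec_CondE) auto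
next
  case (Cond_false s r P' t s' P)
  from Cond_false.prems Cond_false.hyps(1) Cond_false.IH show ?case by (cases rule: exec_CondE) auto
next
  case (While_true s r P t s' t' s3)
  from While_true.prems While_true.hyps(1) obtain v v' s4 where
    *: "exec f w P s v s4" "exec f w (While r P) s4 v' s''" "u = Suc (v + v')"
    by (cases rule: exec_WhileE) auto
  show ?case using While_true.IH(1)[OF *(1)] While_true.IH(2) *(2,3) by auto
next
  case (While_false s r P)
  from While_false.prems While_false.hyps show ?case by (cases rule: exec_WhileE) auto
qed

text \<open>The input \<open>n\<close> is in register 0; the output \<open>\<lambda>i. mem s i\<close> is read off the memory cells
  \<open>0, \<dots>, n - 1\<close> of the final state \<open>s\<close>.\<close>

definition init_state :: "nat \<Rightarrow> state" where
  "init_state n = \<lparr>reg = (\<lambda>_. 0)(0 := n), mem = (\<lambda>_. 0), asked = [], flips = 0\<rparr>"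

definition legal_queries :: "nat \<Rightarrow> (nat \<times> nat) list \<Rightarrow> bool" where
  "legal_queries n qs \<longleftrightarrow>
     (\<forall>(x, y) \<in> set qs. x < n \<and> y < n \<and> x \<noteq> y) \<and> distinct (map (\<lambda>(x, y). {x, y}) qs)"

definition recovers :: "nat \<Rightarrow> nat \<Rightarrow> (nat \<Rightarrow> nat) \<Rightarrow> (nat \<Rightarrow> nat) \<Rightarrow> bool" where
  "recovers k n g h \<longleftrightarrow> (\<exists>c<k. \<forall>i<n. h i = (g i + c) mod k)"

text \<open>
  The parameter \<open>L\<close> is the number of coins provided. For a program with running time at most
  \<open>L\<close> the value does not depend on it, because each flip takes one time unit.
\<close>

definition recovery_prob :: "com \<Rightarrow> nat \<Rightarrow> nat \<Rightarrow> real \<Rightarrow> nat \<Rightarrow> (nat \<Rightarrow> nat) \<Rightarrow> real" where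
  "recovery_prob P L k q n g =
     measure_pmf.prob
       (pair_pmf (oracle_pmf k q n g) (Pi_pmf {..<L} False (\<lambda>_. bernoulli_pmf (1/2))))
       {(f, w). \<exists>t s. exec f w P (init_state n) t s \<and> recovers k n g (mem s)}"

end

theory Submission
  imports Defs "HOL-Real_Asymp.Real_Asymp"
begin

text \<open>
  The difference of two answers \<open>(y, x)\<close> and \<open>(0, x)\<close> is \<open>g(y) - g(0)\<close> plus the difference of
  two independent noise terms. The law of that difference is the autocorrelation of the law of the
  noise on \<open>\<int>/k\<close>, so it has its unique maximum at \<open>0\<close> unless the noise is invariant under
  some translation; for \<open>0 < q \<le> 1/2\<close> this happens only if \<open>k = 2\<close> and \<open>q = 1/2\<close>.
  Fix \<open>m = C \<lceil>log n\<rceil>\<close> references, ask every pair that contains one of them, and let every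
  reference \<open>x \<noteq> y\<close> vote for the value of \<open>g(y) - g(0)\<close>. The votes on one \<open>y\<close> involve disjoint
  sets of pairs. By Hoeffding's inequality the plurality is wrong with probability at most
  \<open>k exp(-\<Omega>(m))\<close>, which for large \<open>C\<close> survives a union bound over \<open>y\<close>.
\<close>

section \<open>Execution within a time bound\<close>

text \<open>A total-correctness triple with a time budget. \<open>exec\<close> is deterministic, so
  exhibiting one halting run describes the only one; an upper bound on the time lets branches of
  different length share a budget.\<close>

definition runs ::
  "(nat \<times> nat \<Rightarrow> nat) \<Rightarrow> (nat \<Rightarrow> bool) \<Rightarrow> com \<Rightarrow> state \<Rightarrow> nat \<Rightarrow> (state \<Rightarrow> bool) \<Rightarrow> bool" where
  "runs f w P s t R \<longleftrightarrow> (\<exists>t' s'. exec f w P s t' s' \<and> t' \<le> t \<and> R s')"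

lemma runs_Seq:
  assumes "runs f w P s t R" "\<And>s'. R s' \<Longrightarrow> runs f w P' s' t' R'"
  shows "runs f w (Seq P P') s (t + t') R'"
  using assms unfolding runs_def by (meson add_mono exec.Seq)

lemma runs_conseq:
  assumes "runs f w P s t R" "\<And>s'. R s' \<Longrightarrow> R' s'" "t \<le> t'"
  shows "runs f w P s t' R'"
  using assms unfolding runs_def by (meson order_trans)

text \<open>The invariant carries the iteration count. Each of the \<open>N\<close> rounds pays one
  unit for its guard, and the final failing guard pays the last unit.\<close>

lemma runs_While:
  assumes "I 0 s"
    and step: "\<And>i s. i < N \<Longrightarrow> I i s \<Longrightarrow> reg s r \<noteq> 0 \<and> runs f w P s t (I (Suc i))"
    and stop: "\<And>s. I N s \<Longrightarrow> reg s r = 0"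
  shows "runs f w (While r P) s (N * Suc t + 1) (I N)"
proof -
  have "runs f w (While r P) s ((N - i) * Suc t + 1) (I N)" if "i \<le> N" "I i s" for i s
    using that
  proof (induction "N - i" arbitrary: i s)
    case 0
    hence "I N s" by simp
    with stop show ?case unfolding runs_def by (metis While_false le_add2)
  next
    case (Suc d)
    hence i: "i < N" by simp
    from step[OF i Suc.prems(2)] obtain u s' where
      s': "reg s r \<noteq> 0" "exec f w P s u s'" "u \<le> t" "I (Suc i) s'"
      unfolding runs_def by blast
    have "runs f w (While r P) s' ((N - Suc i) * Suc t + 1) (I N)"
      using Suc(1)[of "Suc i" s'] Suc(2) i s'(4) by simp
    then obtain u' s'' where
      s'': "exec f w (While r P) s' u' s''" "u' \<le> (N - Suc i) * Suc t + 1" "I N s''"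
      unfolding runs_def by blast
    have "N - i = Suc (N - Suc i)" using i by simp
    hence "Suc (u + u') \<le> (N - i) * Suc t + 1" using s'(3) s''(2) by simp
    with While_true[OF s'(1,2) s''(1)] s''(3) show ?case unfolding runs_def by blast
  qed
  from this[of 0 s] assms(1) show ?thesis by simp
qed

section \<open>Symbolic evaluation of loop-free code\<close>

fun loop_free :: "com \<Rightarrow> bool" where
  "loop_free (Do i) \<longleftrightarrow> True"
| "loop_free (Seq P P') \<longleftrightarrow> loop_free P \<and> loop_free P'"
| "loop_free (Cond r P P') \<longleftrightarrow> loop_free P \<and> loop_free P'"
| "loop_free (While r P) \<longleftrightarrow> False"

text \<open>The \<open>While\<close> equation is a dummy value, as in \<open>cost\<close>: both
  functions are meaningful on loop-free programs only.\<close>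

fun result :: "(nat \<times> nat \<Rightarrow> nat) \<Rightarrow> (nat \<Rightarrow> bool) \<Rightarrow> com \<Rightarrow> state \<Rightarrow> state" where
  "result f w (Do i) s = instr_step f w i s"
| "result f w (Seq P P') s = result f w P' (result f w P s)"
| "result f w (Cond r P P') s = (if reg s r \<noteq> 0 then result f w P s else result f w P' s)"
| "result f w (While r P) s = s"

fun cost :: "com \<Rightarrow> nat" where
  "cost (Do i) = 1"
| "cost (Seq P P') = cost P + cost P'"
| "cost (Cond r P P') = Suc (max (cost P) (cost P'))"
| "cost (While r P) = 1"

text \<open>Without loops a run always halts, so the simplifier can compute the final state from
  \<open>result\<close>; \<open>cost\<close> charges the dearer branch of a conditional. Only the
  loops then need invariants.\<close>

lemma runs_loop_free:
  assumes "loop_free P" "R (result f w P s)"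
  shows "runs f w P s (cost P) R"
proof -
  have "\<exists>t \<le> cost P. exec f w P s t (result f w P s)"
    using assms(1)
  proof (induction P arbitrary: s)
    case (Do i)
    show ?case using exec.Do[of f w i s] by auto
  next
    case (Seq P P')
    thus ?case by simp (meson add_mono exec.Seq)
  next
    case (Cond r P P')
    show ?case
    proof (cases "reg s r = 0")
      case True
      from Cond obtain t where "t \<le> cost P'" "exec f w P' s t (result f w P' s)" by auto
      with True show ?thesis by (auto intro!: exI[of _ "Suc t"] Cond_false)
    next
      case False
      from Cond obtain t where "t \<le> cost P" "exec f w P s t (result f w P s)" by auto
      with False show ?thesis by (auto intro!: exI[of _ "Suc t"] Cond_true)
    qed
  qed simp
  with assms(2) show ?thesis unfolding runs_def by blast
qed

lemma runs_loop_freeI: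
  "loop_free P \<Longrightarrow> cost P \<le> t \<Longrightarrow> R (result f w P s) \<Longrightarrow> runs f w P s t R"
  using runs_loop_free runs_conseq by metis

section \<open>The program\<close>

notation Seq (infixr ";;" 60)

abbreviation (input) "rN \<equiv> 0 :: nat"
abbreviation (input) "rOne \<equiv> 2 :: nat"
abbreviation (input) "rK \<equiv> 3 :: nat"
abbreviation (input) "rK1 \<equiv> 4 :: nat"
abbreviation (input) "rM \<equiv> 5 :: nat"
abbreviation (input) "rY \<equiv> 6 :: nat"
abbreviation (input) "rX \<equiv> 7 :: nat"
abbreviation (input) "rV \<equiv> 8 :: nat"
abbreviation (input) "rRow_y \<equiv> 9 :: nat"
abbreviation (input) "rRow_x \<equiv> 10 :: nat"
abbreviation (input) "rCount \<equiv> 11 :: nat"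
abbreviation (input) "rBest \<equiv> 12 :: nat"
abbreviation (input) "rA \<equiv> 13 :: nat"
abbreviation (input) "rB \<equiv> 14 :: nat"
abbreviation (input) "rLoop_y \<equiv> 15 :: nat"
abbreviation (input) "rLoop_x \<equiv> 16 :: nat"
abbreviation (input) "rLoop_v \<equiv> 17 :: nat"

definition skip :: com where "skip = Do (Const rA 0)"

text \<open>\<open>rX\<close> runs through the powers of two while \<open>rM\<close> grows by
  \<open>C\<close>, so that \<open>C\<close> times the rounded-up binary logarithm arises without
  multiplication.\<close>

definition doubling_body :: "nat \<Rightarrow> com" where
  "doubling_body C =
     Do (Add rX rX rX) ;; Do (Const rA C) ;; Do (Add rM rM rA) ;; Do (Sub rLoop_x rN rX)"

text \<open>The last two instructions cap \<open>rM\<close> at \<open>n\<close>: under truncated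
  subtraction \<open>a - (a - b)\<close> is the minimum of \<open>a\<close> and
  \<open>b\<close>.\<close>

definition size_prog :: "nat \<Rightarrow> nat \<Rightarrow> com" where
  "size_prog k C =
     (Do (Const rOne 1) ;; Do (Const rK k) ;; Do (Const rK1 (k - 1)) ;; Do (Const rX 1) ;;
      Do (Sub rLoop_x rN rX)) ;;
     While rLoop_x (doubling_body C) ;;
     (Do (Sub rA rM rN) ;; Do (Sub rM rM rA))"

text \<open>The guard \<open>y - x\<close> is nonzero iff \<open>x < y\<close>, so every unordered
  pair is asked at most once, smaller item first; its answer is stored in both orientations. Row
  addresses are kept in registers and advanced by \<open>n\<close>, as there is no
  multiplication.\<close>

definition ask_body :: com where
  "ask_body =
     Do (Sub rA rY rX) ;;
     Cond rA
       (Do (Query rA rX rY) ;;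
        Do (Add rB rRow_x rY) ;; Do (Store rB rA) ;;
        Do (Sub rA rK rA) ;; Do (Add rB rRow_y rX) ;; Do (Store rB rA))
       skip ;;
     Do (Add rX rX rOne) ;; Do (Add rRow_x rRow_x rN) ;; Do (Sub rLoop_x rM rX)"

definition ask_row :: com where
  "ask_row =
     (Do (Const rX 0) ;; Do (Add rRow_x rX rN) ;; Do (Sub rLoop_x rM rX)) ;;
     While rLoop_x ask_body ;;
     (Do (Add rY rY rOne) ;; Do (Add rRow_y rRow_y rN) ;; Do (Sub rLoop_y rN rY))"

definition ask_prog :: com where
  "ask_prog =
     (Do (Const rY 0) ;; Do (Add rRow_y rY rN) ;; Do (Sub rLoop_y rN rY)) ;;
     While rLoop_y ask_row"

text \<open>One step of reduction modulo \<open>k\<close>: for positive \<open>k\<close>, the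
  truncated difference to \<open>k - 1\<close> is nonzero iff the value is at least
  \<open>k\<close>.\<close>

definition reduce :: com where
  "reduce = Do (Sub rB rA rK1) ;; Cond rB (Do (Sub rA rA rK)) (Do (Const rB 0))"

text \<open>The sum of the two truncated differences is the distance of \<open>x\<close> and
  \<open>y\<close>, which detects \<open>x = y\<close>. Two reductions suffice because the tested
  number is below \<open>3 * k\<close>.\<close>

definition vote_body :: com where
  "vote_body =
     Do (Sub rA rX rY) ;; Do (Sub rB rY rX) ;; Do (Add rA rA rB) ;;
     Cond rA
       (Do (Add rA rRow_y rX) ;; Do (Load rA rA) ;; Do (Add rB rN rX) ;; Do (Load rB rB) ;;
        Do (Sub rA rK rA) ;; Do (Add rA rA rB) ;; Do (Add rA rA rV) ;;
        reduce ;; reduce ;;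
        Cond rA skip (Do (Add rCount rCount rOne)))
       skip ;;
     Do (Add rX rX rOne) ;; Do (Sub rLoop_x rM rX)"

text \<open>The best candidate so far is kept directly in output cell \<open>y\<close>. References
  start at 1 because item 0 is the base point of all offsets.\<close>

definition candidate_body :: com where
  "candidate_body =
     (Do (Const rCount 0) ;; Do (Const rX 1) ;; Do (Sub rLoop_x rM rX)) ;;
     While rLoop_x vote_body ;;
     (Do (Sub rA rCount rBest) ;;
      Cond rA (Do (Add rBest rBest rA) ;; Do (Store rY rV)) skip ;;
      Do (Add rV rV rOne) ;; Do (Sub rLoop_v rK rV))"

definition decide_row :: com where
  "decide_row =
     (Do (Const rBest 0) ;; Do (Const rV 0) ;; Do (Sub rLoop_v rK rV)) ;;
     While rLoop_v candidate_body ;;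
     (Do (Add rY rY rOne) ;; Do (Add rRow_y rRow_y rN) ;; Do (Sub rLoop_y rN rY))"

text \<open>Item 0 is skipped: its output stays 0, which fixes the free global offset.\<close>

definition decide_prog :: com where
  "decide_prog =
     (Do (Const rY 1) ;; Do (Add rRow_y rN rN) ;; Do (Sub rLoop_y rN rY)) ;;
     While rLoop_y decide_row"

definition recovery_prog :: "nat \<Rightarrow> nat \<Rightarrow> com" where
  "recovery_prog k C = size_prog k C ;; ask_prog ;; decide_prog"

section \<open>Correctness and running time\<close>

definition log_bound :: "nat \<Rightarrow> nat" where
  "log_bound n = (LEAST i. n \<le> 2 ^ i)"

definition num_refs :: "nat \<Rightarrow> nat \<Rightarrow> nat" where
  "num_refs C n = min (C * log_bound n) n"

lemma log_bound_upper: "n \<le> 2 ^ log_bound n"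
  unfolding log_bound_def by (rule LeastI[of _ n]) (simp add: less_imp_le)

lemma log_bound_lower: "i < log_bound n \<Longrightarrow> 2 ^ i < n"
  unfolding log_bound_def using not_less_Least by (meson not_le)

lemma log_bound_le: "log_bound n \<le> n"
  unfolding log_bound_def by (rule Least_le) (simp add: less_imp_le)

definition const_regs :: "nat \<Rightarrow> nat \<Rightarrow> nat \<Rightarrow> state \<Rightarrow> bool" where
  "const_regs k m n s \<longleftrightarrow>
     reg s rN = n \<and> reg s rOne = 1 \<and> reg s rK = k \<and> reg s rK1 = k - 1 \<and> reg s rM = m"

lemma runs_size_prog:
  "runs f w (size_prog k C) (init_state n) (12 + 5 * n)
     (\<lambda>s. const_regs k (num_refs C n) n s \<and> mem s = (\<lambda>_. 0) \<and> asked s = [])"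
proof -
  define I where "I i s \<longleftrightarrow> const_regs k (C * i) n s \<and> mem s = (\<lambda>_. 0) \<and> asked s = [] \<and>
    reg s rX = 2 ^ i \<and> reg s rLoop_x = n - 2 ^ i" for i s
  have 1: "runs f w (Do (Const rOne 1) ;; Do (Const rK k) ;; Do (Const rK1 (k - 1)) ;;
      Do (Const rX 1) ;; Do (Sub rLoop_x rN rX)) (init_state n) 5 (I 0)"
    by (rule runs_conseq[OF runs_loop_free, where R = "I 0"])
      (simp_all add: I_def const_regs_def init_state_def)
  have step: "reg s rLoop_x \<noteq> 0 \<and> runs f w (doubling_body C) s 4 (I (Suc i))"
    if "i < log_bound n" "I i s" for i s
  proof
    show "reg s rLoop_x \<noteq> 0" using log_bound_lower[OF that(1)] that(2) by (simp add: I_def)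
    show "runs f w (doubling_body C) s 4 (I (Suc i))"
      using that(2)
      by (intro runs_conseq[OF runs_loop_free, where R = "I (Suc i)"])
        (simp_all add: I_def const_regs_def doubling_body_def)
  qed
  have 2: "runs f w (While rLoop_x (doubling_body C)) s (log_bound n * Suc 4 + 1) (I (log_bound n))"
    if "I 0 s" for s
    by (rule runs_While[OF that step]) (use log_bound_upper in \<open>auto simp: I_def\<close>)
  have 3: "runs f w (Do (Sub rA rM rN) ;; Do (Sub rM rM rA)) s 2
      (\<lambda>s. const_regs k (num_refs C n) n s \<and> mem s = (\<lambda>_. 0) \<and> asked s = [])"
    if "I (log_bound n) s" for s
    using that
    by (intro runs_conseq[OF runs_loop_free]) (auto simp: I_def const_regs_def num_refs_def)
  show ?thesis unfolding size_prog_def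
    by (rule runs_conseq[OF runs_Seq[OF 1 runs_Seq[OF 2 3]]]) (use log_bound_le[of n] in simp_all)
qed

text \<open>
  The answer to \<open>(a, b)\<close>, or its negation modulo \<open>k\<close> if only \<open>(b, a)\<close> has been asked. The
  negation of \<open>0\<close> is stored as \<open>k\<close>. The program keeps this table in cell \<open>n + a n + b\<close>,
  above the output cells.
\<close>

definition table :: "nat \<Rightarrow> (nat \<times> nat \<Rightarrow> nat) \<Rightarrow> (nat \<times> nat) set \<Rightarrow> nat \<Rightarrow> nat \<Rightarrow> nat" where
  "table k f A a b =
     (if (a, b) \<in> A then f (a, b) else if (b, a) \<in> A then k - f (b, a) else 0)"

text \<open>Progress of the nested loops: rows below \<open>y\<close> are finished and row
  \<open>y\<close> is done up to column \<open>x\<close>.\<close>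

definition asked_upto :: "nat \<Rightarrow> nat \<Rightarrow> nat \<Rightarrow> (nat \<times> nat) set" where
  "asked_upto m y x = {(i, j). i < j \<and> i < m \<and> (j < y \<or> j = y \<and> i < x)}"

lemma asked_upto_Suc:
  "x < m \<Longrightarrow> x < y \<Longrightarrow> asked_upto m y (Suc x) = insert (x, y) (asked_upto m y x)"
  "x \<ge> y \<Longrightarrow> asked_upto m y (Suc x) = asked_upto m y x"
  "asked_upto m (Suc y) 0 = asked_upto m y m"
  by (auto simp: asked_upto_def)

text \<open>Division with remainder by \<open>n\<close> recovers row and column, so distinct table
  entries never share a cell.\<close>

lemma cell_eq_iff:
  fixes n :: nat
  assumes "b < n" "b' < n"
  shows "n + a * n + b = n + a' * n + b' \<longleftrightarrow> a = a' \<and> b = b'"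
proof
  assume "n + a * n + b = n + a' * n + b'"
  hence eq: "b + a * n = b' + a' * n" by simp
  have "(b + a * n) mod n = b" "(b + a * n) div n = a"
    "(b' + a' * n) mod n = b'" "(b' + a' * n) div n = a'"
    using assms by auto
  with eq show "a = a' \<and> b = b'" by metis
qed auto

text \<open>The length bound counts rounds of the inner loop instead of pairs with
  \<open>i < j\<close>; at the end it reads \<open>n * m\<close>, which is good enough for the query
  bound.\<close>

definition table_state ::
  "nat \<Rightarrow> nat \<Rightarrow> nat \<Rightarrow> (nat \<times> nat \<Rightarrow> nat) \<Rightarrow> nat \<Rightarrow> nat \<Rightarrow> state \<Rightarrow> bool" where
  "table_state k m n f y x s \<longleftrightarrow>
     (\<forall>a<n. \<forall>b<n. mem s (n + a * n + b) = table k f (asked_upto m y x) a b) \<and>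
     (\<forall>i<n. mem s i = 0) \<and>
     set (asked s) = asked_upto m y x \<and> distinct (asked s) \<and> length (asked s) \<le> y * m + x"

lemma runs_ask_body:
  assumes "m \<le> n" "x < m" "y < n"
    and "const_regs k m n s" "table_state k m n f y x s"
    and "reg s rX = x" "reg s rY = y" "reg s rRow_x = n + x * n" "reg s rRow_y = n + y * n"
  shows "runs f w ask_body s 12
     (\<lambda>s. const_regs k m n s \<and> table_state k m n f y (Suc x) s \<and>
       reg s rX = Suc x \<and> reg s rY = y \<and> reg s rRow_x = n + Suc x * n \<and> reg s rRow_y = n + y * n \<and>
       reg s rLoop_x = m - Suc x)"
proof (rule runs_loop_freeI)
  show "loop_free ask_body" "cost ask_body \<le> 12" by (simp_all add: ask_body_def skip_def)
  let ?s = "result f w ask_body s"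
  have regs: "const_regs k m n ?s"
      "reg ?s rX = Suc x \<and> reg ?s rY = y \<and> reg ?s rRow_x = n + Suc x * n \<and> reg ?s rRow_y = n + y * n \<and>
       reg ?s rLoop_x = m - Suc x"
    using assms by (auto simp: ask_body_def skip_def const_regs_def)
  have "table_state k m n f y (Suc x) ?s"
  proof (cases "x < y")
    case False
    hence "mem ?s = mem s" "asked ?s = asked s"
      using assms by (auto simp: ask_body_def skip_def const_regs_def)
    with assms(5) False show ?thesis by (simp add: table_state_def asked_upto_Suc)
  next
    case True
    hence mem: "mem ?s = (mem s)(n + x * n + y := f (x, y), n + y * n + x := k - f (x, y))"
      and asked: "asked ?s = (x, y) # asked s"
      using assms by (auto simp: ask_body_def skip_def const_regs_def)
    have "mem ?s (n + a * n + b) = table k f (asked_upto m y (Suc x)) a b" if "a < n" "b < n" for a b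
    proof -
      have x: "x < n" using assms by simp
      have "mem s (n + a * n + b) = table k f (asked_upto m y x) a b"
        using assms(5) that by (simp add: table_state_def)
      \<comment> \<open>Hence the first case of \<open>table\<close> cannot override the negated
        answer just stored in the reversed cell.\<close>
      moreover have "(y, x) \<notin> asked_upto m y x" using True by (simp add: asked_upto_def)
      ultimately show ?thesis
        unfolding mem fun_upd_apply cell_eq_iff[OF that(2) assms(3)] cell_eq_iff[OF that(2) x]
        using True assms(2) by (auto simp: asked_upto_Suc table_def)
    qed
    moreover have "(x, y) \<notin> set (asked s)"
      using assms(5) by (auto simp: table_state_def asked_upto_def)
    ultimately show ?thesis
      using assms(2,5) True by (auto simp: table_state_def asked_upto_Suc asked mem)
  qed
  with regs show "const_regs k m n ?s \<and> table_state k m n f y (Suc x) ?s \<and>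
       reg ?s rX = Suc x \<and> reg ?s rY = y \<and> reg ?s rRow_x = n + Suc x * n \<and> reg ?s rRow_y = n + y * n \<and>
       reg ?s rLoop_x = m - Suc x" by simp
qed

lemma runs_ask_prog:
  assumes "m \<le> n" "const_regs k m n s" "mem s = (\<lambda>_. 0)" "asked s = []"
  shows "runs f w ask_prog s (4 + n * (8 + 13 * m))
     (\<lambda>s. const_regs k m n s \<and> table_state k m n f n 0 s)"
proof -
  define I where "I y s \<longleftrightarrow> const_regs k m n s \<and> table_state k m n f y 0 s \<and>
      reg s rY = y \<and> reg s rRow_y = n + y * n \<and> reg s rLoop_y = n - y" for y s
  have row: "reg s rLoop_y \<noteq> 0 \<and> runs f w ask_row s (7 + 13 * m) (I (Suc y))"
    if "y < n" "I y s" for y s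
  proof
    show "reg s rLoop_y \<noteq> 0" using that by (simp add: I_def)
    define J where "J x s \<longleftrightarrow> const_regs k m n s \<and> table_state k m n f y x s \<and>
        reg s rX = x \<and> reg s rY = y \<and> reg s rRow_x = n + x * n \<and> reg s rRow_y = n + y * n \<and>
        reg s rLoop_x = m - x" for x s
    have 1: "runs f w (Do (Const rX 0) ;; Do (Add rRow_x rX rN) ;; Do (Sub rLoop_x rM rX)) s 3 (J 0)"
      using that
      by (intro runs_conseq[OF runs_loop_free, where R = "J 0"])
        (simp_all add: I_def J_def const_regs_def table_state_def)
    have 2: "runs f w (While rLoop_x ask_body) s (m * Suc 12 + 1) (J m)" if "J 0 s" for s
    proof (rule runs_While[where I = J, OF that])
      fix x s assume x: "x < m" and J: "J x s"
      have "runs f w ask_body s 12 (J (Suc x))"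
        by (rule runs_conseq[OF runs_ask_body[OF assms(1) x \<open>y < n\<close>, of k s f w]])
          (use J in \<open>simp_all add: J_def\<close>)
      with x J show "reg s rLoop_x \<noteq> 0 \<and> runs f w ask_body s 12 (J (Suc x))"
        by (simp add: J_def)
    qed (simp add: J_def)
    have 3: "runs f w (Do (Add rY rY rOne) ;; Do (Add rRow_y rRow_y rN) ;; Do (Sub rLoop_y rN rY)) s 3
        (I (Suc y))" if "J m s" for s
      using that
      by (intro runs_conseq[OF runs_loop_free, where R = "I (Suc y)"])
        (simp_all add: I_def J_def const_regs_def table_state_def asked_upto_Suc)
    show "runs f w ask_row s (7 + 13 * m) (I (Suc y))"
      unfolding ask_row_def by (rule runs_conseq[OF runs_Seq[OF 1 runs_Seq[OF 2 3]]]) simp_all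
  qed
  have 1: "runs f w (Do (Const rY 0) ;; Do (Add rRow_y rY rN) ;; Do (Sub rLoop_y rN rY)) s 3 (I 0)"
    using assms
    by (intro runs_conseq[OF runs_loop_free, where R = "I 0"])
      (simp_all add: I_def const_regs_def table_state_def asked_upto_def table_def)
  have 2: "runs f w (While rLoop_y ask_row) s (n * Suc (7 + 13 * m) + 1) (I n)" if "I 0 s" for s
    by (rule runs_While[where I = I, OF that row]) (simp_all add: I_def)
  show ?thesis unfolding ask_prog_def
    by (rule runs_conseq[OF runs_Seq[OF 1 2]]) (simp_all add: I_def)
qed

section \<open>Counting votes and taking the plurality\<close>

primrec best :: "(nat \<Rightarrow> nat) \<Rightarrow> nat \<Rightarrow> nat \<times> nat" where
  "best c 0 = (0, 0)"
| "best c (Suc v) = (if fst (best c v) < c v then (c v, v) else best c v)"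

text \<open>Before \<open>v\<close> the running maximum stays below \<open>c v\<close>; at
  \<open>v\<close> it is overtaken, and no later count exceeds it.\<close>

lemma best_unique_max:
  assumes "v < N" "\<And>u. u < N \<Longrightarrow> u \<noteq> v \<Longrightarrow> c u < c v" "0 < c v"
  shows "snd (best c N) = v"
proof -
  have "(i \<le> v \<longrightarrow> fst (best c i) < c v) \<and> (v < i \<longrightarrow> best c i = (c v, v))" if "i \<le> N" for i
    using that
  proof (induction i)
    case 0
    thus ?case using assms(3) by simp
  next
    case (Suc i)
    thus ?case using assms(2)[of i] by (cases "i = v") auto
  qed
  from this[of N] assms(1) show ?thesis by simp
qed

text \<open>
  Congruence of \<open>D y x\<close> and \<open>D 0 x + v\<close> modulo \<open>k\<close>, without truncation as table entries are at
  most \<open>k\<close>. A reference does not vote on itself.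
\<close>

definition vote :: "nat \<Rightarrow> (nat \<Rightarrow> nat \<Rightarrow> nat) \<Rightarrow> nat \<Rightarrow> nat \<Rightarrow> nat \<Rightarrow> bool" where
  "vote k D y x v \<longleftrightarrow> x \<noteq> y \<and> k dvd k - D y x + D 0 x + v"

definition votes :: "nat \<Rightarrow> (nat \<Rightarrow> nat \<Rightarrow> nat) \<Rightarrow> nat \<Rightarrow> nat \<Rightarrow> nat \<Rightarrow> nat" where
  "votes k D m y v = card {x \<in> {1..<m}. vote k D y x v}"

lemma votes_Suc:
  "1 \<le> x \<Longrightarrow> votes k D (Suc x) y v = votes k D x y v + of_bool (vote k D y x v)"
proof -
  assume "1 \<le> x"
  hence "{x' \<in> {1..<Suc x}. vote k D y x' v} =
      {x' \<in> {1..<x}. vote k D y x' v} \<union> (if vote k D y x v then {x} else {})"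
    by (auto simp: less_Suc_eq)
  thus ?thesis unfolding votes_def by (auto simp: card_insert_if)
qed

definition reduced :: "nat \<Rightarrow> nat \<Rightarrow> nat" where
  "reduced k c = (if c - (k - 1) \<noteq> 0 then c - k else c)"

lemma result_reduce:
  assumes "reg s rK1 = reg s rK - 1"
  shows "result f w reduce s = s\<lparr>reg := (reg s)
     (rB := reg s rA - (reg s rK - 1), rA := reduced (reg s rK) (reg s rA))\<rparr>"
  using assms by (cases s) (auto simp: reduce_def reduced_def fun_eq_iff)

text \<open>Each reduction preserves the residue and removes one \<open>k\<close> if possible; from
  below \<open>3 * k\<close>, two of them reach the remainder.\<close>

lemma reduced_reduced_eq_0:
  assumes "0 < k" "c < 3 * k"
  shows "reduced k (reduced k c) = 0 \<longleftrightarrow> k dvd c"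
proof -
  have "reduced k (reduced k c) mod k = c mod k" "reduced k (reduced k c) < k"
    using assms by (auto simp: reduced_def le_mod_geq not_le)
  thus ?thesis by (metis dvd_eq_mod_eq_0 mod_less)
qed

lemma runs_vote_body:
  assumes "m \<le> n" "x < m" "y < n" "v < k"
    and D: "\<And>a b. a < n \<Longrightarrow> b < n \<Longrightarrow> mem s (n + a * n + b) = D a b"
    and D_le: "\<And>a b. a < n \<Longrightarrow> b < n \<Longrightarrow> D a b \<le> k"
    and "const_regs k m n s"
    and "reg s rX = x" "reg s rY = y" "reg s rV = v" "reg s rRow_y = n + y * n"
  shows "runs f w vote_body s 21
     (\<lambda>s'. const_regs k m n s' \<and> mem s' = mem s \<and> asked s' = asked s \<and>
       reg s' rX = Suc x \<and> reg s' rY = y \<and> reg s' rV = v \<and> reg s' rRow_y = n + y * n \<and>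
       reg s' rBest = reg s rBest \<and>
       reg s' rCount = reg s rCount + of_bool (vote k D y x v) \<and>
       reg s' rLoop_x = m - Suc x)"
proof (rule runs_loop_freeI)
  show "loop_free vote_body" "cost vote_body \<le> 21"
    by (simp_all add: vote_body_def skip_def reduce_def)
  let ?s = "result f w vote_body s"
  \<comment> \<open>Row 0 of the table begins at cell \<open>n\<close>.\<close>
  have cells: "mem s (n + y * n + x) = D y x" "mem s (n + x) = D 0 x"
    using D[of y x] D[of 0 x] assms(1-3) by auto
  have D_le': "D y x \<le> k" "D 0 x \<le> k" using D_le assms(1-3) by auto
  define c where "c = k - D y x + D 0 x + v"
  have "c < 3 * k" using D_le' assms(4) unfolding c_def by linarith
  with assms(4) have "reduced k (reduced k c) = 0 \<longleftrightarrow> k dvd c"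
    by (intro reduced_reduced_eq_0) auto
  note red = this
  show "const_regs k m n ?s \<and> mem ?s = mem s \<and> asked ?s = asked s \<and>
       reg ?s rX = Suc x \<and> reg ?s rY = y \<and> reg ?s rV = v \<and> reg ?s rRow_y = n + y * n \<and>
       reg ?s rBest = reg s rBest \<and>
       reg ?s rCount = reg s rCount + of_bool (vote k D y x v) \<and>
       reg ?s rLoop_x = m - Suc x"
  proof (cases "x = y")
    case True
    thus ?thesis using assms(7-) by (simp add: vote_body_def skip_def const_regs_def vote_def result_reduce)
  next
    case False
    hence "x - y + (y - x) \<noteq> 0" by simp
    with False show ?thesis using assms(7-) red
      by (simp add: vote_body_def skip_def const_regs_def vote_def result_reduce cells c_def[symmetric])
  qed
qed

definition decided :: "nat \<Rightarrow> (nat \<Rightarrow> nat \<Rightarrow> nat) \<Rightarrow> nat \<Rightarrow> nat \<Rightarrow> nat" where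
  "decided k D m y = snd (best (votes k D m y) k)"

context
  fixes k m n :: nat and D :: "nat \<Rightarrow> nat \<Rightarrow> nat" and f :: "nat \<times> nat \<Rightarrow> nat" and w :: "nat \<Rightarrow> bool"
  assumes m_le: "m \<le> n"
    and D_le: "\<And>a b. a < n \<Longrightarrow> b < n \<Longrightarrow> D a b \<le> k"
begin

lemma runs_candidate_body:
  assumes "y < n" "v < k" "const_regs k m n s"
    and D: "\<And>a b. a < n \<Longrightarrow> b < n \<Longrightarrow> mem s (n + a * n + b) = D a b"
    and "reg s rY = y" "reg s rV = v" "reg s rRow_y = n + y * n"
    and "reg s rBest = fst (best (votes k D m y) v)" "mem s y = snd (best (votes k D m y) v)"
  shows "runs f w candidate_body s (12 + 22 * m)
     (\<lambda>s'. const_regs k m n s' \<and> asked s' = asked s \<and>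
       reg s' rY = y \<and> reg s' rV = Suc v \<and> reg s' rRow_y = n + y * n \<and>
       reg s' rBest = fst (best (votes k D m y) (Suc v)) \<and>
       mem s' = (mem s)(y := snd (best (votes k D m y) (Suc v))) \<and>
       reg s' rLoop_v = k - Suc v)"
    (is "runs f w _ _ _ ?R")
proof -
  \<comment> \<open>After \<open>i\<close> rounds the next reference is \<open>Suc i\<close>, since
    reference 0 is left out; there are \<open>m - 1\<close> rounds.\<close>
  define I where "I i s' \<longleftrightarrow> const_regs k m n s' \<and> mem s' = mem s \<and> asked s' = asked s \<and>
       reg s' rX = Suc i \<and> reg s' rY = y \<and> reg s' rV = v \<and> reg s' rRow_y = n + y * n \<and>
       reg s' rBest = fst (best (votes k D m y) v) \<and>
       reg s' rCount = votes k D (Suc i) y v \<and> reg s' rLoop_x = m - Suc i" for i s'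
  have 1: "runs f w (Do (Const rCount 0) ;; Do (Const rX 1) ;; Do (Sub rLoop_x rM rX)) s 3 (I 0)"
    by (rule runs_loop_freeI) (use assms in \<open>simp_all add: I_def const_regs_def votes_def\<close>)
  have 2: "runs f w (While rLoop_x vote_body) s' ((m - 1) * Suc 21 + 1) (I (m - 1))" if "I 0 s'" for s'
  proof (rule runs_While[where I = I, OF that])
    fix i s' assume i: "i < m - 1" and I: "I i s'"
    have x: "Suc i < m" using i by simp
    have "runs f w vote_body s' 21 (I (Suc i))"
    proof (rule runs_conseq[OF runs_vote_body[OF m_le x assms(1,2) _ D_le]])
      show "mem s' (n + a * n + b) = D a b" if "a < n" "b < n" for a b
        using I D[OF that] by (simp add: I_def)
    qed (use I in \<open>simp_all add: I_def votes_Suc\<close>)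
    with x I show "reg s' rLoop_x \<noteq> 0 \<and> runs f w vote_body s' 21 (I (Suc i))"
      by (simp add: I_def)
  qed (auto simp: I_def)
  have 3: "runs f w
      (Do (Sub rA rCount rBest) ;;
       Cond rA (Do (Add rBest rBest rA) ;; Do (Store rY rV)) skip ;;
       Do (Add rV rV rOne) ;; Do (Sub rLoop_v rK rV)) s' 6 ?R" if "I (m - 1) s'" for s'
  proof (rule runs_loop_freeI)
    \<comment> \<open>For \<open>m = 0\<close> the two bounds differ, but both ranges of references
      are empty.\<close>
    have "votes k D (Suc (m - 1)) y v = votes k D m y v"
      by (cases m) (simp_all add: votes_def)
    moreover have "(mem s)(y := snd (best (votes k D m y) v)) = mem s"
      using assms(9) by (metis fun_upd_triv)
    ultimately show "?R (result f w
       (Do (Sub rA rCount rBest) ;;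
       Cond rA (Do (Add rBest rBest rA) ;; Do (Store rY rV)) skip ;;
       Do (Add rV rV rOne) ;; Do (Sub rLoop_v rK rV)) s')"
      using that unfolding I_def by (auto simp: const_regs_def skip_def not_less)
  qed (simp_all add: skip_def)
  show ?thesis unfolding candidate_body_def
    by (rule runs_conseq[OF runs_Seq[OF 1 runs_Seq[OF 2 3]]]) simp_all
qed

lemma runs_decide_prog:
  assumes "0 < k" "const_regs k m n s" "\<And>i. i < n \<Longrightarrow> mem s i = 0"
    and D: "\<And>a b. a < n \<Longrightarrow> b < n \<Longrightarrow> mem s (n + a * n + b) = D a b"
  shows "runs f w decide_prog s (4 + n * (8 + k * (13 + 22 * m)))
     (\<lambda>s'. asked s' = asked s \<and> (\<forall>i<n. mem s' i = (if i = 0 then 0 else decided k D m i)))"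
proof -
  \<comment> \<open>The memory once items \<open>1\<close> to \<open>i\<close> are decided; the
    cells from \<open>n\<close> on hold the table, which is only read.\<close>
  define out where "out i = (\<lambda>j. if j < n then if 1 \<le> j \<and> j \<le> i then decided k D m j else 0 else mem s j)" for i
  define I where "I i s' \<longleftrightarrow> const_regs k m n s' \<and> asked s' = asked s \<and> mem s' = out i \<and>
      reg s' rY = Suc i \<and> reg s' rRow_y = n + Suc i * n \<and> reg s' rLoop_y = n - Suc i" for i s'
  have row: "reg s' rLoop_y \<noteq> 0 \<and> runs f w decide_row s' (7 + k * (13 + 22 * m)) (I (Suc i))"
    if i: "i < n - 1" and I: "I i s'" for i s'
  proof
    show "reg s' rLoop_y \<noteq> 0" using that by (simp add: I_def)
    define y where "y = Suc i"
    have y: "y < n" using i by (simp add: y_def)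
    define J where "J v s'' \<longleftrightarrow> const_regs k m n s'' \<and> asked s'' = asked s \<and>
        mem s'' = (out i)(y := snd (best (votes k D m y) v)) \<and>
        reg s'' rY = y \<and> reg s'' rV = v \<and> reg s'' rRow_y = n + y * n \<and>
        reg s'' rBest = fst (best (votes k D m y) v) \<and> reg s'' rLoop_v = k - v" for v s''
    have 1: "runs f w (Do (Const rBest 0) ;; Do (Const rV 0) ;; Do (Sub rLoop_v rK rV)) s' 3 (J 0)"
    proof (rule runs_loop_freeI)
      have "(out i)(y := 0) = out i" using y by (auto simp: out_def y_def)
      thus "J 0 (result f w (Do (Const rBest 0) ;; Do (Const rV 0) ;; Do (Sub rLoop_v rK rV)) s')"
        using I by (simp add: I_def J_def const_regs_def y_def)
    qed simp_all
    have 2: "runs f w (While rLoop_v candidate_body) s'' (k * Suc (12 + 22 * m) + 1) (J k)"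
      if "J 0 s''" for s''
    proof (rule runs_While[where I = J, OF that])
      fix v s'' assume v: "v < k" and J: "J v s''"
      have "runs f w candidate_body s'' (12 + 22 * m) (J (Suc v))"
      proof (rule runs_conseq[OF runs_candidate_body[OF y v]])
        show "mem s'' (n + a * n + b) = D a b" if "a < n" "b < n" for a b
          using J D[OF that] y by (simp add: J_def out_def)
      qed (use J in \<open>simp_all add: J_def\<close>)
      with v J show "reg s'' rLoop_v \<noteq> 0 \<and> runs f w candidate_body s'' (12 + 22 * m) (J (Suc v))"
        by (simp add: J_def)
    qed (simp add: J_def)
    have 3: "runs f w (Do (Add rY rY rOne) ;; Do (Add rRow_y rRow_y rN) ;; Do (Sub rLoop_y rN rY)) s'' 3
        (I (Suc i))" if "J k s''" for s''
    proof (rule runs_loop_freeI)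
      have "(out i)(y := snd (best (votes k D m y) k)) = out (Suc i)"
        using y by (auto simp: out_def decided_def y_def)
      thus "I (Suc i) (result f w
          (Do (Add rY rY rOne) ;; Do (Add rRow_y rRow_y rN) ;; Do (Sub rLoop_y rN rY)) s'')"
        using that by (simp add: I_def J_def const_regs_def y_def)
    qed simp_all
    show "runs f w decide_row s' (7 + k * (13 + 22 * m)) (I (Suc i))"
      unfolding decide_row_def by (rule runs_conseq[OF runs_Seq[OF 1 runs_Seq[OF 2 3]]]) simp_all
  qed
  have 1: "runs f w (Do (Const rY 1) ;; Do (Add rRow_y rN rN) ;; Do (Sub rLoop_y rN rY)) s 3 (I 0)"
  proof (rule runs_loop_freeI)
    have "mem s = out 0" using assms(3) by (auto simp: out_def)
    thus "I 0 (result f w (Do (Const rY 1) ;; Do (Add rRow_y rN rN) ;; Do (Sub rLoop_y rN rY)) s)"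
      using assms(2) by (simp add: I_def const_regs_def)
  qed simp_all
  have 2: "runs f w (While rLoop_y decide_row) s' ((n - 1) * Suc (7 + k * (13 + 22 * m)) + 1) (I (n - 1))"
    if "I 0 s'" for s'
    by (rule runs_While[where I = I, OF that row]) (auto simp: I_def)
  show ?thesis unfolding decide_prog_def
    by (rule runs_conseq[OF runs_Seq[OF 1 2]]) (auto simp: I_def out_def)
qed

end

text \<open>The finished table as a function of the oracle alone. For asked pairs, entry
  \<open>(y, x)\<close> is a noisy value of \<open>g y - g x\<close> modulo \<open>k\<close>, in
  either orientation.\<close>

definition answers :: "nat \<Rightarrow> nat \<Rightarrow> (nat \<times> nat \<Rightarrow> nat) \<Rightarrow> nat \<Rightarrow> nat \<Rightarrow> nat" where
  "answers k m f y x =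
     (if x < y \<and> x < m then k - f (x, y) else if y < x \<and> y < m then f (y, x) else 0)"

lemma runs_recovery_prog:
  assumes k: "0 < k" and f: "\<And>p. f p < k" and m_def: "m = num_refs C n"
  shows "runs f w (recovery_prog k C) (init_state n)
     (20 + 5 * n + n * (8 + 13 * n) + n * (8 + k * (13 + 22 * n)))
     (\<lambda>s. legal_queries n (asked s) \<and> length (asked s) \<le> n * num_refs C n \<and>
       (\<forall>i<n. mem s i = (if i = 0 then 0 else decided k (answers k m f) m i)))"
proof -
  have m_le: "m \<le> n" by (simp add: m_def num_refs_def)
  let ?R = "\<lambda>s. const_regs k m n s \<and> table_state k m n f n 0 s"
  have 2: "runs f w ask_prog s (4 + n * (8 + 13 * m)) ?R"
    if "const_regs k m n s \<and> mem s = (\<lambda>_. 0) \<and> asked s = []" for s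
    using runs_ask_prog[OF m_le] that by blast
  have 3: "runs f w decide_prog s (4 + n * (8 + k * (13 + 22 * m)))
     (\<lambda>s. legal_queries n (asked s) \<and> length (asked s) \<le> n * num_refs C n \<and>
       (\<forall>i<n. mem s i = (if i = 0 then 0 else decided k (answers k m f) m i)))"
    if R: "?R s" for s
  proof -
    have D_le: "answers k m f a b \<le> k" if "a < n" "b < n" for a b
      using f by (simp add: answers_def less_imp_le)
    have D: "mem s (n + a * n + b) = answers k m f a b" if "a < n" "b < n" for a b
      using R that by (auto simp: table_state_def table_def answers_def asked_upto_def)
    have asked: "set (asked s) = {(i, j). i < j \<and> i < m \<and> j < n}" "distinct (asked s)"
      and length: "length (asked s) \<le> n * m"
      using R by (auto simp: table_state_def asked_upto_def)
    \<comment> \<open>All asked pairs are increasing, so the unordered pair determines the ordered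
      one and distinctness carries over.\<close>
    have "inj_on (\<lambda>(x, y). {x, y}) (set (asked s))"
      unfolding asked(1) by (auto simp: inj_on_def doubleton_eq_iff)
    hence "legal_queries n (asked s)"
      using asked by (auto simp: legal_queries_def distinct_map)
    moreover have "runs f w decide_prog s (4 + n * (8 + k * (13 + 22 * m)))
     (\<lambda>s'. asked s' = asked s \<and> (\<forall>i<n. mem s' i = (if i = 0 then 0 else decided k (answers k m f) m i)))"
      by (rule runs_decide_prog[OF m_le D_le k _ _ D]) (use R in \<open>auto simp: table_state_def\<close>)
    ultimately show ?thesis
      using length by (elim runs_conseq) (simp_all add: m_def)
  qed
  have "n * (8 + 13 * m) + n * (8 + k * (13 + 22 * m)) \<le> n * (8 + 13 * n) + n * (8 + k * (13 + 22 * n))"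
    using m_le by (intro add_mono mult_mono) auto
  hence le: "12 + 5 * n + (4 + n * (8 + 13 * m) + (4 + n * (8 + k * (13 + 22 * m))))
      \<le> 20 + 5 * n + n * (8 + 13 * n) + n * (8 + k * (13 + 22 * n))" by simp
  have 1: "runs f w (size_prog k C) (init_state n) (12 + 5 * n)
      (\<lambda>s. const_regs k m n s \<and> mem s = (\<lambda>_. 0) \<and> asked s = [])"
    unfolding m_def by (rule runs_size_prog)
  show ?thesis
    unfolding recovery_prog_def by (rule runs_conseq[OF runs_Seq[OF 1 runs_Seq[OF 2 3]] _ le])
qed

section \<open>Concentration of the votes\<close>

text \<open>
  Here \<open>\<sigma> = \<plusminus>1\<close> because the noise of a pair changes sign when the pair is read backwards. For
  \<open>k \<ge> 3\<close> the bound \<open>(1 - 3 q / 2)\<^sup>2\<close> is exact for \<open>k = 3\<close>.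
\<close>

lemma vote_margin:
  fixes k d \<sigma> :: int and q :: real
  assumes "2 \<le> k" "0 < q" "q \<le> 1/2" "\<not> k dvd d" "\<sigma> = 1 \<or> \<sigma> = -1"
  defines "w \<equiv> (\<lambda>e :: int. if e = 0 then 1 - q else q / 2)"
  shows "(if k = 2 then (1 - 2 * q)\<^sup>2 else (1 - 3 * q / 2)\<^sup>2) \<le>
    (\<Sum>e\<in>{0, 1, -1}. \<Sum>e'\<in>{0, 1, -1}. w e * w e' *
       (of_bool (k dvd \<sigma> * e + e') - of_bool (k dvd d + \<sigma> * e + e')))"
proof -
  define r :: "int \<Rightarrow> real" where "r j = of_bool (k dvd d + j)" for j
  define z :: "int \<Rightarrow> real" where "z j = of_bool (k dvd j)" for j
  have r_eq: "of_bool (k dvd d + \<sigma> * e + e') = r (\<sigma> * e + e')" for e e'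
    by (simp add: o_def add.assoc r_def)
  have z_eq: "of_bool (k dvd \<sigma> * e + e') = z (\<sigma> * e + e')" for e e'
    by (simp add: z_def)
  \<comment> \<open>Group the nine terms by the value of the total noise: 0 has weight
    \<open>(1 - q)\<^sup>2 + q\<^sup>2 / 2\<close>, each of 1 and -1 has \<open>q * (1 - q)\<close>,
    each of 2 and -2 has \<open>q\<^sup>2 / 4\<close>. These weights are symmetric, so \<sigma>
    disappears.\<close>
  have sum_eq: "(\<Sum>e\<in>{0, 1, -1}. \<Sum>e'\<in>{0, 1, -1}. w e * w e' *
       (of_bool (k dvd \<sigma> * e + e') - of_bool (k dvd d + \<sigma> * e + e'))) =
     ((1 - q)\<^sup>2 + q\<^sup>2 / 2) * (z 0 - r 0) + q * (1 - q) * (z 1 + z (-1) - r 1 - r (-1)) +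
     q\<^sup>2 / 4 * (z 2 + z (-2) - r 2 - r (-2))"
    unfolding r_eq z_eq w_def using assms(5)
    by (auto simp: power2_eq_square field_simps)
  have r0: "r 0 = 0" and z0: "z 0 = 1" using assms(4) by (simp_all add: r_def z_def)
  have z1: "z 1 = 0" "z (-1) = 0" using assms(1) by (auto simp: z_def zdvd1_eq)
  have q: "0 \<le> q * (1 - 2 * q)" "0 \<le> (1 - 2 * q) * (1 - 2 * q)" "0 \<le> q * q"
    using assms(2,3) by auto
  \<comment> \<open>Two shifts closer than \<open>k\<close> cannot both hit the class of
    \<open>-d\<close>.\<close>
  have distinct: "r i = 0 \<or> r j = 0" if "0 < i - j" "i - j < k" for i j
  proof (rule ccontr)
    assume "\<not> ?thesis"
    hence "k dvd (d + i) - (d + j)" by (intro dvd_diff) (auto simp: r_def)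
    with that show False using zdvd_imp_le by fastforce
  qed
  have r01: "r j = 0 \<or> r j = 1" for j by (simp add: r_def)
  \<comment> \<open>For small \<open>k\<close> the noise values wrap around: 2 meets 0, -1 or -2 for
    \<open>k\<close> equal to 2, 3 or 4. From 5 on, the five values are distinct residues.\<close>
  consider "k = 2" | "k = 3" | "k = 4" | "5 \<le> k" using assms(1) by linarith
  thus ?thesis
  proof cases
    case 1
    have "z 2 = 1" "z (-2) = 1" by (simp_all add: z_def 1)
    moreover have "r 1 = 1" "r (-1) = 1" "r 2 = 0" "r (-2) = 0"
      using assms(4) by (auto simp: r_def 1)
    ultimately show ?thesis
      unfolding sum_eq r0 z0 z1 by (simp add: 1 power2_eq_square field_simps)
  next
    case 2
    have "z 2 = 0" "z (-2) = 0" by (simp_all add: z_def 2)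
    moreover have "r 1 = 1 \<and> r (-1) = 0 \<and> r 2 = 0 \<and> r (-2) = 1 \<or>
        r 1 = 0 \<and> r (-1) = 1 \<and> r 2 = 1 \<and> r (-2) = 0"
      using assms(4) unfolding r_def 2 of_bool_eq_0_iff of_bool_eq_1_iff by presburger
    ultimately show ?thesis
      unfolding sum_eq r0 z0 z1 by (auto simp: 2 power2_eq_square field_simps)
  next
    case 3
    have "z 2 = 0" "z (-2) = 0" by (simp_all add: z_def 3)
    moreover have "r 2 = r (-2)"
    proof -
      have "4 dvd d + 2 \<longleftrightarrow> 4 dvd d + -2" by presburger
      thus ?thesis by (simp add: r_def 3)
    qed
    moreover have "r 1 = 0 \<or> r (-1) = 0" "r 2 = 0 \<or> r 1 = 0" "r 2 = 0 \<or> r (-1) = 0"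
      by (rule distinct; simp add: 3)+
    ultimately show ?thesis
      unfolding sum_eq r0 z0 z1 using r01[of 1] r01[of "-1"] r01[of "-2"] q assms(2,3)
      by (auto simp: 3 power2_eq_square field_simps)
  next
    case 4
    hence z2: "z 2 = 0" "z (-2) = 0" and "k \<noteq> 2" by (auto simp: z_def dest: zdvd_imp_le)
    have "r 1 = 0 \<or> r (-1) = 0" "r 2 = 0 \<or> r 1 = 0" "r 2 = 0 \<or> r (-1) = 0"
        "r 2 = 0 \<or> r (-2) = 0" "r 1 = 0 \<or> r (-2) = 0" "r (-1) = 0 \<or> r (-2) = 0"
      by (rule distinct; use 4 in simp)+
    hence sums: "r 1 + r (-1) + (r 2 + r (-2)) \<le> 1"
      using r01[of 1] r01[of 2] r01[of "-1"] r01[of "-2"] by (elim disjE) simp_all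
    define A where "A = r 1 + r (-1)"
    define B where "B = r 2 + r (-2)"
    have AB: "0 \<le> A" "0 \<le> B" "A + B \<le> 1"
      using sums by (simp_all add: A_def B_def r_def)
    \<comment> \<open>A wrong class catches at most one of the four nonzero noise values, and the
      heaviest of these has weight \<open>q * (1 - q)\<close>.\<close>
    have "q\<^sup>2 / 4 * B \<le> q * (1 - q) * B"
      using AB(2) assms(2,3) by (intro mult_right_mono) (auto simp: power2_eq_square)
    moreover have "q * (1 - q) * (A + B) \<le> q * (1 - q) * 1"
      using AB(3) assms(2,3) by (intro mult_left_mono) auto
    ultimately have "q * (1 - q) * A + q\<^sup>2 / 4 * B \<le> q * (1 - q)"
      by (simp add: distrib_left)
    moreover have "(1 - 3 * q / 2)\<^sup>2 + q\<^sup>2 / 4 = (1 - q)\<^sup>2 + q\<^sup>2 / 2 - q * (1 - q)"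
      by (simp add: power2_eq_square field_simps)
    ultimately have "(1 - 3 * q / 2)\<^sup>2 \<le>
        (1 - q)\<^sup>2 + q\<^sup>2 / 2 - (q * (1 - q) * A + q\<^sup>2 / 4 * B)"
      using zero_le_power2[of q] by linarith
    thus ?thesis
      unfolding sum_eq r0 z0 z1 z2 using \<open>k \<noteq> 2\<close>
      by (simp add: A_def B_def algebra_simps add_divide_distrib)
  qed
qed

section \<open>Hoeffding's inequality for functions of disjoint pairs of coordinates\<close>

lemma map_Pi_pmf_two_components:
  assumes "finite I" "i \<in> I" "j \<in> I" "i \<noteq> j"
  shows "map_pmf (\<lambda>f. (f i, f j)) (Pi_pmf I d p) = pair_pmf (p i) (p j)"
proof -
  let ?J = "I - {i}"
  have I: "I = insert i ?J" using assms by auto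
  have "map_pmf (\<lambda>f. (f i, f j)) (Pi_pmf I d p) =
      map_pmf (\<lambda>(y, f). (y, f j)) (pair_pmf (p i) (Pi_pmf ?J d p))"
    by (subst I, subst Pi_pmf_insert)
      (use assms in \<open>auto simp: pmf.map_comp o_def case_prod_unfold\<close>)
  also have "\<dots> = pair_pmf (p i) (map_pmf (\<lambda>f. f j) (Pi_pmf ?J d p))"
    by (simp add: pair_map_pmf2 apsnd_def map_prod_def case_prod_unfold)
  also have "map_pmf (\<lambda>f. f j) (Pi_pmf ?J d p) = p j"
    using assms by (simp add: Pi_pmf_component)
  finally show ?thesis .
qed

text \<open>Disjoint coordinate blocks make the summands independent. A nonpositive sum is then a
  deviation of at least \<delta> per summand from the mean.\<close>

lemma prob_sum_nonpos_le:
  fixes z :: "'x \<Rightarrow> 'b :: countable \<Rightarrow> 'b \<Rightarrow> real" and p :: "'i \<Rightarrow> 'b pmf"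
  assumes "finite I" "finite X" "0 \<le> \<delta>"
    and ab: "\<And>x. x \<in> X \<Longrightarrow> a x \<in> I \<and> b x \<in> I \<and> a x \<noteq> b x"
    and disj: "disjoint_family_on (\<lambda>x. {a x, b x}) X"
    and bound: "\<And>x u v. \<bar>z x u v\<bar> \<le> 1"
    and mean: "\<And>x. x \<in> X \<Longrightarrow>
      \<delta> \<le> measure_pmf.expectation (pair_pmf (p (a x)) (p (b x))) (\<lambda>(u, v). z x u v)"
  shows "measure_pmf.prob (Pi_pmf I d p) {f. (\<Sum>x\<in>X. z x (f (a x)) (f (b x))) \<le> 0}
    \<le> exp (- (real (card X) * \<delta>\<^sup>2 / 2))"
proof (cases "X = {}")
  case False
  let ?M = "Pi_pmf I d p"
  define Z where "Z x f = z x (f (a x)) (f (b x))" for x and f :: "'i \<Rightarrow> 'b"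
  have "prob_space.indep_vars ?M (\<lambda>_. count_space UNIV) (\<lambda>i f. f i) I"
    using assms(1) by (rule indep_vars_Pi_pmf)
  hence "prob_space.indep_vars ?M (\<lambda>x. PiM {a x, b x} (\<lambda>_. count_space UNIV))
      (\<lambda>x f. restrict (\<lambda>i. f i) {a x, b x}) X"
    by (rule prob_space.indep_vars_restrict[OF measure_pmf.prob_space_axioms]) (use ab disj in auto)
  hence "prob_space.indep_vars ?M (\<lambda>_. borel)
      (\<lambda>x f. Z x (restrict (\<lambda>i. f i) {a x, b x})) X"
  proof (rule prob_space.indep_vars_compose2[OF measure_pmf.prob_space_axioms])
    fix x
    let ?P = "PiM {a x, b x} (\<lambda>_. count_space UNIV) :: ('i \<Rightarrow> 'b) measure"
    have [measurable]: "(\<lambda>f. f (a x)) \<in> ?P \<rightarrow>\<^sub>M count_space UNIV" "(\<lambda>f. f (b x)) \<in> ?P \<rightarrow>\<^sub>M count_space UNIV"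
      by (rule measurable_component_singleton; simp)+
    show "Z x \<in> borel_measurable ?P"
      unfolding Z_def
      by (rule measurable_compose_countable[where g = "\<lambda>f. f (a x)"],
          rule measurable_compose_countable[where g = "\<lambda>f. f (b x)"]) measurable
  qed
  hence indep: "prob_space.indep_vars ?M (\<lambda>_. borel) Z X"
    by (simp add: Z_def[abs_def])
  define \<mu> where "\<mu> = (\<Sum>x\<in>X. measure_pmf.expectation ?M (Z x))"
  interpret Hoeffding_ineq ?M X Z "\<lambda>_. -1" "\<lambda>_. 1" \<mu>
    by unfold_locales
      (use assms(2) indep bound in \<open>auto simp: \<mu>_def Z_def abs_le_iff minus_le_iff\<close>)
  have "\<delta> \<le> measure_pmf.expectation ?M (Z x)" if "x \<in> X" for x
  proof -
    have "measure_pmf.expectation ?M (Z x) =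
        measure_pmf.expectation (map_pmf (\<lambda>f. (f (a x), f (b x))) ?M) (\<lambda>(u, v). z x u v)"
      by (simp add: Z_def[abs_def])
    also have "map_pmf (\<lambda>f. (f (a x), f (b x))) ?M = pair_pmf (p (a x)) (p (b x))"
      using ab[OF that] assms(1) by (intro map_Pi_pmf_two_components) auto
    finally show ?thesis using mean[OF that] by simp
  qed
  hence mu: "real (card X) * \<delta> \<le> \<mu>"
    unfolding \<mu>_def by (rule sum_bounded_below)
  have card: "0 < real (card X)" using False assms(2) by (simp add: card_gt_0_iff)
  have mu0: "0 \<le> \<mu>" using mu assms(3) card by (meson mult_nonneg_nonneg less_imp_le order_trans)
  \<comment> \<open>The deviation is taken to be the whole mean \<mu>; each summand ranges over an
    interval of length 2.\<close>
  have "measure_pmf.prob ?M {f. (\<Sum>x\<in>X. z x (f (a x)) (f (b x))) \<le> 0} =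
      measure_pmf.prob ?M {f \<in> space ?M. (\<Sum>x\<in>X. Z x f) \<le> \<mu> - \<mu>}"
    by (simp add: Z_def)
  also have "\<dots> \<le> exp (- 2 * \<mu>\<^sup>2 / (\<Sum>x\<in>X. (1 - (-1))\<^sup>2))"
    by (rule Hoeffding_ineq_le) (use mu0 card in auto)
  also have "\<dots> = exp (- (\<mu>\<^sup>2 / (2 * real (card X))))"
    by simp
  also have "\<dots> \<le> exp (- (real (card X) * \<delta>\<^sup>2 / 2))"
  proof -
    have "(real (card X) * \<delta>)\<^sup>2 \<le> \<mu>\<^sup>2" using mu assms(3) card by (intro power_mono) auto
    thus ?thesis using card by (simp add: field_simps power2_eq_square)
  qed
  finally show ?thesis .
qed simp

section \<open>Expectations over noisy answers\<close>

lemma set_answer_pmf: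
  assumes "0 \<le> q" "q \<le> 1"
  shows "set_pmf (answer_pmf k q g x y) \<subseteq> shifted_diff k g x y ` {0, 1, -1}"
  using assms by (auto simp: set_pmf_iff pmf_answer_pmf split: if_splits)

lemma shifted_diff_less: "0 < k \<Longrightarrow> shifted_diff k g x y e < k"
  unfolding shifted_diff_def by (simp add: nat_less_iff)

text \<open>Summing over noise values instead of answers counts coinciding answers with
  multiplicity, which is how the law adds their weights. This covers \<open>k = 2\<close>.\<close>

lemma expectation_answer_pmf:
  fixes h :: "nat \<Rightarrow> real"
  assumes "0 \<le> q" "q \<le> 1"
  shows "measure_pmf.expectation (answer_pmf k q g x y) h =
    (\<Sum>e\<in>{0, 1, -1}. (if e = 0 then 1 - q else q / 2) * h (shifted_diff k g x y e))"
proof -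
  let ?A = "shifted_diff k g x y ` {0, 1, -1}"
  have "measure_pmf.expectation (answer_pmf k q g x y) h =
      (\<Sum>a\<in>?A. pmf (answer_pmf k q g x y) a * h a)"
    using set_answer_pmf[OF assms, of k g x y] by (subst integral_measure_pmf[of ?A]) auto
  also have "\<dots> = (\<Sum>a\<in>?A. (if a = shifted_diff k g x y 0 then (1 - q) * h a else 0) +
      (if a = shifted_diff k g x y 1 then q / 2 * h a else 0) +
      (if a = shifted_diff k g x y (-1) then q / 2 * h a else 0))"
    by (intro sum.cong) (auto simp: pmf_answer_pmf[OF assms] algebra_simps)
  also have "\<dots> = (1 - q) * h (shifted_diff k g x y 0) + q / 2 * h (shifted_diff k g x y 1) +
      q / 2 * h (shifted_diff k g x y (-1))"
    by (simp add: sum.distrib del: image_insert)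
  also have "\<dots> = (\<Sum>e\<in>{0, 1, -1}. (if e = 0 then 1 - q else q / 2) * h (shifted_diff k g x y e))"
    by simp
  finally show ?thesis .
qed

lemma expectation_pair_pmf_finite:
  fixes h :: "'a \<Rightarrow> 'b \<Rightarrow> real"
  assumes "finite (set_pmf p)" "finite (set_pmf r)"
  shows "measure_pmf.expectation (pair_pmf p r) (\<lambda>(u, v). h u v) =
    measure_pmf.expectation p (\<lambda>u. measure_pmf.expectation r (h u))"
proof -
  have "measure_pmf.expectation (pair_pmf p r) (\<lambda>(u, v). h u v) =
      (\<Sum>(u, v)\<in>set_pmf p \<times> set_pmf r. pmf p u * pmf r v * h u v)"
    using assms by (subst integral_measure_pmf[of "set_pmf p \<times> set_pmf r"])
      (auto simp: pmf_pair intro!: sum.cong)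
  also have "\<dots> = (\<Sum>u\<in>set_pmf p. pmf p u * (\<Sum>v\<in>set_pmf r. pmf r v * h u v))"
    by (simp add: sum.cartesian_product[symmetric] sum_distrib_left mult.assoc)
  also have "\<dots> = measure_pmf.expectation p (\<lambda>u. measure_pmf.expectation r (h u))"
    using assms by (simp add: integral_measure_pmf[of "set_pmf p"] integral_measure_pmf[of "set_pmf r"])
  finally show ?thesis .
qed

lemma expectation_two_answers:
  fixes h :: "nat \<Rightarrow> nat \<Rightarrow> real"
  assumes "0 \<le> q" "q \<le> 1"
  shows "measure_pmf.expectation (pair_pmf (answer_pmf k q g a b) (answer_pmf k q g a' b')) (\<lambda>(u, v). h u v) =
    (\<Sum>e\<in>{0, 1, -1}. \<Sum>e'\<in>{0, 1, -1}. (if e = 0 then 1 - q else q / 2) * (if e' = 0 then 1 - q else q / 2) *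
       h (shifted_diff k g a b e) (shifted_diff k g a' b' e'))"
proof -
  have fin: "finite (set_pmf (answer_pmf k q g x y))" for x y
    by (rule finite_subset[OF set_answer_pmf[OF assms]]) simp
  show ?thesis
    unfolding expectation_pair_pmf_finite[OF fin fin] expectation_answer_pmf[OF assms]
    by (simp only: sum_distrib_left mult.assoc)
qed

definition offset :: "nat \<Rightarrow> (nat \<Rightarrow> nat) \<Rightarrow> nat \<Rightarrow> nat" where
  "offset k g y = nat ((int (g y) - int (g 0)) mod int k)"

text \<open>The vote of reference \<open>x\<close> as a function of the answers \<open>u\<close> to the pair \<open>{x, y}\<close> and
  \<open>v\<close> to the pair \<open>{0, x}\<close>, each asked with the smaller item first.\<close>

definition ballot :: "nat \<Rightarrow> nat \<Rightarrow> nat \<Rightarrow> nat \<Rightarrow> nat \<Rightarrow> nat \<Rightarrow> bool" where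
  "ballot k y c x u v \<longleftrightarrow> k dvd k - (if x < y then k - u else u) + v + c"

text \<open>Modulo \<open>k\<close> the unknown \<open>g x\<close> cancels between the two answers.
  For \<open>x < y\<close> the pair is used as asked, otherwise it is negated together with its
  noise.\<close>

lemma ballot_shifted_diff:
  assumes "0 < k"
  shows "ballot k y c x (shifted_diff k g (min x y) (max x y) e) (shifted_diff k g 0 x e') \<longleftrightarrow>
    int k dvd (int c - int (offset k g y)) + (if x < y then 1 else -1) * e + e'"
proof -
  define u where "u = shifted_diff k g (min x y) (max x y) e"
  define v where "v = shifted_diff k g 0 x e'"
  let ?s = "if x < y then 1 else -1 :: int"
  have "u < k" unfolding u_def by (rule shifted_diff_less[OF assms])
  \<comment> \<open>As \<open>u < k\<close>, no subtraction truncates, and the computation can move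
    to the integers.\<close>
  hence total: "int (k - (if x < y then k - u else u) + v + c) =
      (if x < y then int u else int k - int u) + int v + int c"
    by auto
  have rem: "\<exists>j. int (nat (i mod int k)) = i + int k * j" for i
  proof (rule exI)
    have "int (nat (i mod int k)) = i mod int k" using assms by simp
    also have "\<dots> = i + int k * - (i div int k)" by (simp add: minus_mult_div_eq_mod[symmetric])
    finally show "int (nat (i mod int k)) = i + int k * - (i div int k)" .
  qed
  obtain j1 j2 j3 where
    "int u = int (g (min x y)) - int (g (max x y)) + e + int k * j1"
    "int v = int (g 0) - int (g x) + e' + int k * j2"
    "int (offset k g y) = int (g y) - int (g 0) + int k * j3"
    using rem unfolding u_def v_def offset_def shifted_diff_def by meson
  hence "int (k - (if x < y then k - u else u) + v + c) =
      (int c - int (offset k g y)) + ?s * e + e' +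
      int k * (if x < y then j1 + j2 + j3 else 1 - j1 + j2 + j3)"
    unfolding total by (auto simp: algebra_simps)
  thus ?thesis unfolding ballot_def u_def[symmetric] v_def[symmetric]
    by (metis dvd_add_left_iff dvd_triv_left int_dvd_int_iff)
qed

lemma vote_answers:
  assumes "0 < y" "0 < x" "x < m" "x \<noteq> y"
  shows "vote k (answers k m f) y x c \<longleftrightarrow>
    ballot k y c x (f (min x y, max x y)) (f (0, x))"
  using assms by (auto simp: vote_def ballot_def answers_def min_def max_def)

lemma votes_diff:
  assumes "0 < y"
  shows "real (votes k (answers k m f) m y c) - real (votes k (answers k m f) m y c') =
    (\<Sum>x\<in>{1..<m} - {y}. of_bool (ballot k y c x (f (min x y, max x y)) (f (0, x))) -
       of_bool (ballot k y c' x (f (min x y, max x y)) (f (0, x))))"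
proof -
  have "real (votes k (answers k m f) m y c) =
      (\<Sum>x\<in>{1..<m} - {y}. of_bool (ballot k y c x (f (min x y, max x y)) (f (0, x))))" for c
  proof -
    have "{x \<in> {1..<m}. vote k (answers k m f) y x c} =
        {x \<in> {1..<m} - {y}. ballot k y c x (f (min x y, max x y)) (f (0, x))}"
      using vote_answers[OF assms, of _ m k f c] by (auto simp: vote_def)
    thus ?thesis by (simp add: votes_def of_bool_def sum.If_cases Int_def)
  qed
  thus ?thesis by (simp add: sum_subtractf)
qed

text \<open>The bound of \<open>vote_margin\<close> on the expected lead of the true offset per
  vote. For \<open>q\<close> between 0 and 1/2 it vanishes only at \<open>k = 2\<close>,
  \<open>q = 1/2\<close>.\<close>

definition margin :: "nat \<Rightarrow> real \<Rightarrow> real" where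
  "margin k q = (if k = 2 then (1 - 2 * q)\<^sup>2 else (1 - 3 * q / 2)\<^sup>2)"

lemma prob_votes_le:
  assumes k: "2 \<le> k" and q: "0 < q" "q \<le> 1/2" and "m \<le> n" "0 < y" "y < n"
    and c: "c < k" "c \<noteq> offset k g y"
  shows "measure_pmf.prob (oracle_pmf k q n g)
     {f. votes k (answers k m f) m y (offset k g y) \<le> votes k (answers k m f) m y c}
    \<le> exp (- ((real m - 2) * (margin k q)\<^sup>2 / 2))"
proof -
  let ?c = "offset k g y"
  let ?X = "{1..<m} - {y}"
  let ?p = "\<lambda>(x, y). answer_pmf k q g x y"
  define z :: "nat \<Rightarrow> nat \<Rightarrow> nat \<Rightarrow> real" where
    "z x u v = of_bool (ballot k y ?c x u v) - of_bool (ballot k y c x u v)" for x u v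
  have c': "?c < k" using k by (simp add: offset_def nat_less_iff)
  have d: "\<not> int k dvd int c - int ?c"
  proof
    assume "int k dvd int c - int ?c"
    hence "c mod k = ?c mod k" by (metis mod_eq_dvd_iff of_nat_eq_iff of_nat_mod)
    with c c' show False by simp
  qed
  have "measure_pmf.prob (oracle_pmf k q n g)
     {f. votes k (answers k m f) m y ?c \<le> votes k (answers k m f) m y c} =
    measure_pmf.prob (Pi_pmf ({..<n} \<times> {..<n}) 0 ?p)
     {f. (\<Sum>x\<in>?X. z x (f (min x y, max x y)) (f (0, x))) \<le> 0}"
    unfolding oracle_pmf_def z_def votes_diff[OF assms(5), symmetric] by simp
  also have "\<dots> \<le> exp (- (real (card ?X) * (margin k q)\<^sup>2 / 2))"
  proof (rule prob_sum_nonpos_le)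
    show "disjoint_family_on (\<lambda>x. {(min x y, max x y), (0, x)}) ?X"
      using assms(5) by (auto simp: disjoint_family_on_def min_def max_def split: if_splits)
    show "margin k q \<le> measure_pmf.expectation (pair_pmf (?p (min x y, max x y)) (?p (0, x))) (\<lambda>(u, v). z x u v)"
      if "x \<in> ?X" for x
    proof -
      have "0 < k" "0 \<le> q" "q \<le> 1" using k q by auto
      define \<sigma> :: int where "\<sigma> = (if x < y then 1 else -1)"
      have "\<sigma> = 1 \<or> \<sigma> = -1" by (simp add: \<sigma>_def)
      from vote_margin[OF _ q d this] k show ?thesis
        unfolding prod.case expectation_two_answers[OF \<open>0 \<le> q\<close> \<open>q \<le> 1\<close>] z_def
          ballot_shifted_diff[OF \<open>0 < k\<close>] \<sigma>_def[symmetric] margin_def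
        by simp
    qed
  qed (use assms in \<open>auto simp: margin_def z_def\<close>)
  also have "\<dots> \<le> exp (- ((real m - 2) * (margin k q)\<^sup>2 / 2))"
  proof -
    \<comment> \<open>The 2 subtracted from \<open>m\<close> accounts for reference 0 and for
      \<open>y\<close>, which may itself be a reference.\<close>
    have "card {1..<m} \<le> Suc (card ?X)"
      using card_Suc_Diff1[of "{1..<m}" y] by (cases "y \<in> {1..<m}") auto
    hence "real m - 2 \<le> real (card ?X)" by simp
    thus ?thesis by (simp add: mult_right_mono)
  qed
  finally show ?thesis .
qed

section \<open>Success probability\<close>

definition decisive :: "nat \<Rightarrow> nat \<Rightarrow> nat \<Rightarrow> (nat \<Rightarrow> nat) \<Rightarrow> (nat \<times> nat \<Rightarrow> nat) \<Rightarrow> bool" where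
  "decisive k m n g f \<longleftrightarrow> (\<forall>y\<in>{1..<n}. \<forall>c\<in>{..<k} - {offset k g y}.
     votes k (answers k m f) m y c < votes k (answers k m f) m y (offset k g y))"

lemma recovers_if_decisive:
  assumes "2 \<le> k" "decisive k m n g f"
    and h: "\<And>i. i < n \<Longrightarrow> h i = (if i = 0 then 0 else decided k (answers k m f) m i)"
  shows "recovers k n g h"
proof -
  have offset: "offset k g i < k" for i
    using assms(1) by (simp add: offset_def nat_less_iff)
  have "h i = offset k g i" if "i < n" for i
  proof (cases "i = 0")
    case True
    with h[OF that] show ?thesis by (simp add: offset_def)
  next
    case False
    let ?v = "votes k (answers k m f) m i"
    have less: "?v c < ?v (offset k g i)" if "c < k" "c \<noteq> offset k g i" for c
      using assms(2) False \<open>i < n\<close> that by (simp add: decisive_def)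
    \<comment> \<open>Since \<open>k\<close> is at least 2 there is a loser, and beating it strictly
      forces a positive count.\<close>
    have "\<exists>c<k. c \<noteq> offset k g i" using assms(1) by (intro exI[of _ "if offset k g i = 0 then 1 else 0"]) auto
    with less have "0 < ?v (offset k g i)" by (metis not_gr_zero not_less_zero)
    with less offset have "decided k (answers k m f) m i = offset k g i"
      unfolding decided_def by (intro best_unique_max) auto
    with h[OF that] False show ?thesis by simp
  qed
  \<comment> \<open>The global shift is \<open>- g 0\<close> modulo \<open>k\<close>, because output
    0 is pinned to 0.\<close>
  moreover have "offset k g i = (g i + nat (- int (g 0) mod int k)) mod k" for i
  proof -
    have "int (offset k g i) = (int (g i) + - int (g 0) mod int k) mod int k"
      using assms(1) by (simp add: offset_def mod_simps)
    also have "\<dots> = int ((g i + nat (- int (g 0) mod int k)) mod k)"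
      using assms(1) by (simp add: of_nat_mod)
    finally show ?thesis by simp
  qed
  moreover have "nat (- int (g 0) mod int k) < k" using assms(1) by (simp add: nat_less_iff)
  ultimately show ?thesis unfolding recovers_def by metis
qed

lemma oracle_less:
  assumes "2 \<le> k" "0 \<le> q" "q \<le> 1" "f \<in> set_pmf (oracle_pmf k q n g)"
  shows "f p < k"
proof (cases "p \<in> {..<n} \<times> {..<n}")
  case True
  then obtain x y where p: "p = (x, y)" "x < n" "y < n" by auto
  have "f p \<in> set_pmf (answer_pmf k q g x y)"
    using assms(4) p unfolding oracle_pmf_def by (auto simp: set_Pi_pmf PiE_dflt_def)
  with set_answer_pmf[OF assms(2,3), of k g x y] show ?thesis
    using shifted_diff_less[of k g x y] assms(1) by auto
next
  case False
  with assms(4) have "f p = 0"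
    unfolding oracle_pmf_def by (cases p) (auto simp: set_Pi_pmf PiE_dflt_def)
  with assms(1) show ?thesis by simp
qed

text \<open>Union bound over the items \<open>y\<close> and their wrong offsets \<open>c\<close>, at
  most \<open>n * k\<close> events.\<close>

lemma prob_not_decisive:
  assumes "2 \<le> k" "0 < q" "q \<le> 1/2" "m \<le> n"
  shows "measure_pmf.prob (oracle_pmf k q n g) {f. \<not> decisive k m n g f}
    \<le> real n * real k * exp (- ((real m - 2) * (margin k q)\<^sup>2 / 2))"
proof -
  let ?O = "oracle_pmf k q n g" and ?b = "exp (- ((real m - 2) * (margin k q)\<^sup>2 / 2))"
  let ?I = "SIGMA y:{1..<n}. {..<k} - {offset k g y}"
  let ?A = "\<lambda>(y, c). {f. votes k (answers k m f) m y (offset k g y) \<le> votes k (answers k m f) m y c}"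
  have "{f. \<not> decisive k m n g f} = (\<Union>i\<in>?I. ?A i)"
    by (auto simp: decisive_def not_less)
  hence "measure_pmf.prob ?O {f. \<not> decisive k m n g f} \<le> (\<Sum>i\<in>?I. measure_pmf.prob ?O (?A i))"
    by (simp only:) (rule measure_pmf.finite_measure_subadditive_finite; simp)
  also have "\<dots> \<le> real (card ?I) * ?b"
  proof (rule sum_bounded_above)
    fix i assume "i \<in> ?I"
    then obtain y c where "i = (y, c)" "y \<in> {1..<n}" "c \<in> {..<k} - {offset k g y}"
      by (rule SigmaE)
    thus "measure_pmf.prob ?O (?A i) \<le> ?b" using prob_votes_le[OF assms] by simp
  qed
  also have "\<dots> \<le> real (n * k) * ?b"
  proof -
    have "card ?I \<le> card ({..<n} \<times> {..<k})" by (intro card_mono) auto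
    hence "card ?I \<le> n * k" by (simp only: card_cartesian_product card_lessThan)
    thus ?thesis by (intro mult_right_mono) (simp_all only: of_nat_le_iff exp_ge_zero)
  qed
  finally show ?thesis by simp
qed

definition time_poly :: "nat \<Rightarrow> nat poly" where
  "time_poly k = [:20:] + [:5:] * [:0, 1:] + [:0, 1:] * ([:8:] + [:13:] * [:0, 1:]) +
     [:0, 1:] * ([:8:] + [:k:] * ([:13:] + [:22:] * [:0, 1:]))"

lemma recovery_prog_correct:
  assumes "2 \<le> k" "0 \<le> q" "q \<le> 1" "f \<in> set_pmf (oracle_pmf k q n g)"
  shows "\<exists>t s. exec f w (recovery_prog k C) (init_state n) t s \<and> t \<le> poly (time_poly k) n \<and>
    legal_queries n (asked s) \<and> length (asked s) \<le> n * num_refs C n \<and>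
    (decisive k (num_refs C n) n g f \<longrightarrow> recovers k n g (mem s))"
proof -
  have "runs f w (recovery_prog k C) (init_state n)
     (20 + 5 * n + n * (8 + 13 * n) + n * (8 + k * (13 + 22 * n)))
     (\<lambda>s. legal_queries n (asked s) \<and> length (asked s) \<le> n * num_refs C n \<and>
       (\<forall>i<n. mem s i = (if i = 0 then 0 else
         decided k (answers k (num_refs C n) f) (num_refs C n) i)))"
    by (rule runs_recovery_prog) (use assms(1) oracle_less[OF assms] in auto)
  moreover have "20 + 5 * n + n * (8 + 13 * n) + n * (8 + k * (13 + 22 * n)) = poly (time_poly k) n"
    by (simp add: time_poly_def algebra_simps)
  ultimately show ?thesis
    unfolding runs_def using recovers_if_decisive[OF assms(1)] by metis
qed

lemma recovery_prob_ge:
  assumes "2 \<le> k" "0 < q" "q \<le> 1/2"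
  shows "1 - real n * real k * exp (- ((real (num_refs C n) - 2) * (margin k q)\<^sup>2 / 2))
    \<le> recovery_prob (recovery_prog k C) L k q n g"
proof -
  let ?m = "num_refs C n" and ?O = "oracle_pmf k q n g"
  let ?W = "Pi_pmf {..<L} False (\<lambda>_. bernoulli_pmf (1/2))"
  let ?D = "{f. decisive k ?m n g f}"
  have "1 - real n * real k * exp (- ((real ?m - 2) * (margin k q)\<^sup>2 / 2))
      \<le> 1 - measure_pmf.prob ?O {f. \<not> decisive k ?m n g f}"
    using prob_not_decisive[OF assms, of ?m n g] by (simp add: num_refs_def)
  also have "\<dots> = measure_pmf.prob ?O ?D"
    using measure_pmf.prob_compl[of ?D ?O] by (simp add: Compl_eq_Diff_UNIV[symmetric] Collect_neg_eq)
  \<comment> \<open>Decisiveness depends on the oracle alone, so the coins can be adjoined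
    freely.\<close>
  also have "\<dots> = measure_pmf.prob (map_pmf fst (pair_pmf ?O ?W)) ?D"
    by (simp add: map_fst_pair_pmf)
  also have "\<dots> = measure_pmf.prob (pair_pmf ?O ?W) (fst -` ?D)"
    by (simp add: measure_map_pmf)
  also have "\<dots> \<le> recovery_prob (recovery_prog k C) L k q n g"
    unfolding recovery_prob_def
  proof (rule measure_pmf.finite_measure_mono_AE)
    have "\<exists>t s. exec f w (recovery_prog k C) (init_state n) t s \<and> recovers k n g (mem s)"
      if "f \<in> set_pmf ?O" "decisive k ?m n g f" for f w
      using recovery_prog_correct[OF assms(1) _ _ that(1), of w C] that(2) assms(2,3) by auto
    thus "AE x in measure_pmf (pair_pmf ?O ?W). x \<in> fst -` ?D \<longrightarrow>
        x \<in> {(f, w). \<exists>t s. exec f w (recovery_prog k C) (init_state n) t s \<and> recovers k n g (mem s)}"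
      by (auto simp: AE_measure_pmf_iff)
  qed simp
  finally show ?thesis .
qed

section \<open>Asymptotics\<close>

lemma ln_le_log_bound: "1 \<le> n \<Longrightarrow> ln (real n) \<le> real (log_bound n)"
proof -
  assume n: "1 \<le> n"
  have "real n \<le> 2 ^ log_bound n" using log_bound_upper[of n] by (metis of_nat_le_iff of_nat_numeral of_nat_power)
  hence "ln (real n) \<le> ln (2 ^ log_bound n)" using n by simp
  also have "\<dots> = real (log_bound n) * ln 2" by (simp add: ln_realpow)
  also have "\<dots> \<le> real (log_bound n) * 1" using ln_2_less_1 by (intro mult_left_mono) auto
  finally show ?thesis by simp
qed

lemma log_bound_le_log: "1 \<le> n \<Longrightarrow> real (log_bound n) \<le> 1 + log 2 (real n)"
proof (cases "log_bound n")
  case (Suc i)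
  assume n: "1 \<le> n"
  have "2 ^ i < n" by (rule log_bound_lower) (simp add: Suc)
  hence "2 ^ i \<le> real n" by (metis less_imp_le of_nat_less_iff of_nat_numeral of_nat_power)
  hence "real i \<le> log 2 (real n)" using n by (simp add: le_log_iff powr_realpow)
  thus ?thesis by (simp add: Suc)
qed simp

lemma eventually_num_refs:
  assumes "0 < C"
  shows "\<forall>\<^sub>F n in sequentially. num_refs C n = C * log_bound n"
proof -
  have "0 < real C" using assms by simp
  hence "\<forall>\<^sub>F n in sequentially. real C * (1 + log 2 (real n)) \<le> real n" by real_asymp
  moreover have "\<forall>\<^sub>F n in sequentially. 1 \<le> (n :: nat)" by (rule eventually_ge_at_top)
  ultimately show ?thesis
  proof eventually_elim
    case (elim n)
    have "real (C * log_bound n) \<le> real C * (1 + log 2 (real n))"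
      using log_bound_le_log[OF elim(2)] by (simp add: mult_left_mono)
    also note elim(1)
    finally show ?case unfolding num_refs_def by (simp only: of_nat_le_iff min_absorb1)
  qed
qed

text \<open>With \<open>4 \<le> real C * (margin k q)\<^sup>2\<close> the exponential is at most a
  constant over \<open>n\<^sup>2\<close>. The union bound costs a factor \<open>n * k\<close>, which
  leaves a failure probability of order \<open>1 / n\<close>.\<close>

lemma recovery_prob_tendsto:
  assumes "2 \<le> k" "0 < q" "q \<le> 1/2" "0 < C" "4 \<le> real C * (margin k q)\<^sup>2"
  shows "(\<lambda>n. recovery_prob (recovery_prog k C) (L n) k q n (G n)) \<longlonglongrightarrow> 1"
proof (rule tendsto_sandwich)
  \<comment> \<open>The factor \<open>exp ((margin k q)\<^sup>2)\<close> pays for the two lost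
    references in \<open>m - 2\<close>.\<close>
  define b where "b = real k * exp ((margin k q)\<^sup>2)"
  show "(\<lambda>n. 1 - b / real n) \<longlonglongrightarrow> 1" by real_asymp
  show "\<forall>\<^sub>F n in sequentially. 1 - b / real n \<le> recovery_prob (recovery_prog k C) (L n) k q n (G n)"
    using eventually_num_refs[OF assms(4)] eventually_ge_at_top[of 1]
  proof eventually_elim
    case (elim n)
    let ?M = "(margin k q)\<^sup>2"
    have "2 * ln (real n) \<le> (real C * ?M / 2) * real (log_bound n)"
      using ln_le_log_bound[OF elim(2)] assms(5) elim(2) by (intro mult_mono) auto
    hence "- ((real (num_refs C n) - 2) * ?M / 2) \<le> ?M - 2 * ln (real n)"
      by (simp add: elim(1) field_simps)
    hence "exp (- ((real (num_refs C n) - 2) * ?M / 2)) \<le> exp (?M - 2 * ln (real n))" by simp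
    also have "\<dots> = exp ?M / (real n)\<^sup>2"
      using elim(2) by (simp add: exp_diff exp_double)
    finally have "real n * real k * exp (- ((real (num_refs C n) - 2) * ?M / 2))
        \<le> real n * real k * (exp ?M / (real n)\<^sup>2)"
      by (intro mult_left_mono) auto
    also have "\<dots> = b / real n"
      using elim(2) by (simp add: b_def power2_eq_square)
    finally show ?case using recovery_prob_ge[OF assms(1-3), of n C "L n" "G n"] by linarith
  qed
  show "\<forall>\<^sub>F n in sequentially. recovery_prob (recovery_prog k C) (L n) k q n (G n) \<le> 1"
    unfolding recovery_prob_def by simp
qed (rule tendsto_const)

text \<open>Chosen so that \<open>n\<close> to this power is \<open>num_refs C n + 1\<close> for
  \<open>n \<ge> 2\<close>; adding 1 keeps the logarithm nonnegative. It tends to 0 like a double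
  logarithm over a logarithm.\<close>

definition excess :: "nat \<Rightarrow> nat \<Rightarrow> real" where
  "excess C n = ln (real (num_refs C n) + 1) / ln (real n)"

lemma excess_tendsto_0:
  assumes "0 < C"
  shows "excess C \<longlonglongrightarrow> 0"
proof (rule tendsto_sandwich)
  show "\<forall>\<^sub>F n in sequentially. 0 \<le> excess C n"
    by (rule eventually_mono[OF eventually_ge_at_top[of 1]]) (simp add: excess_def)
  have C: "0 < real C" using assms by simp
  show "(\<lambda>n. ln (real C * (1 + log 2 (real n)) + 1) / ln (real n)) \<longlonglongrightarrow> 0"
    using C by real_asymp
  show "\<forall>\<^sub>F n in sequentially. excess C n \<le> ln (real C * (1 + log 2 (real n)) + 1) / ln (real n)"
    using eventually_ge_at_top[of 2]
  proof eventually_elim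
    case (elim n)
    have "real (num_refs C n) \<le> real C * real (log_bound n)"
      unfolding num_refs_def by (metis min.cobounded1 of_nat_le_iff of_nat_mult)
    also have "\<dots> \<le> real C * (1 + log 2 (real n))"
      using log_bound_le_log[of n] elim by (intro mult_left_mono) auto
    finally show ?case unfolding excess_def using elim by (intro divide_right_mono) auto
  qed
qed (rule tendsto_const)

lemma queries_bigo: "(\<lambda>n. real (n * num_refs C n)) \<in> O(\<lambda>n. real n powr (1 + excess C n))"
proof (rule bigoI[of _ 1])
  show "\<forall>\<^sub>F n in sequentially. norm (real (n * num_refs C n)) \<le> 1 * norm (real n powr (1 + excess C n))"
    using eventually_ge_at_top[of 2]
  proof eventually_elim
    case (elim n)
    have "real n powr excess C n = real (num_refs C n) + 1"
      using elim by (simp add: excess_def powr_def)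
    hence "real n powr (1 + excess C n) = real n * (real (num_refs C n) + 1)"
      using elim by (simp add: powr_add)
    thus ?case by (simp add: mult_left_mono)
  qed
qed

theorem theorem1:
  fixes k :: nat and q :: real
  assumes "2 \<le> k" and "0 < q" and "q \<le> 1/2"
    and nondegenerate: "\<not> (k = 2 \<and> q = 1/2)"
  shows "\<exists>(P :: com) (T :: nat poly) (Q :: nat \<Rightarrow> nat) (\<epsilon> :: nat \<Rightarrow> real).
    (\<forall>n. \<forall>g \<in> {..<n} \<rightarrow> {..<k}. \<forall>f \<in> set_pmf (oracle_pmf k q n g). \<forall>w.
       \<exists>t s. exec f w P (init_state n) t s \<and> t \<le> poly T n \<and>
             legal_queries n (asked s) \<and> length (asked s) \<le> Q n) \<and>
    \<epsilon> \<longlonglongrightarrow> 0 \<and> (\<lambda>n. real (Q n)) \<in> O(\<lambda>n. real n powr (1 + \<epsilon> n)) \<and>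
    (\<forall>G. (\<forall>n. G n \<in> {..<n} \<rightarrow> {..<k}) \<longrightarrow>
       (\<lambda>n. recovery_prob P (poly T n) k q n (G n)) \<longlonglongrightarrow> 1)"
proof -
  have "margin k q \<noteq> 0"
    using assms by (auto simp: margin_def)
  hence margin: "0 < (margin k q)\<^sup>2" by simp
  \<comment> \<open>\<open>C\<close> depends on \<open>k\<close> and \<open>q\<close> only, so one
    program serves all \<open>n\<close>.\<close>
  obtain C :: nat where C: "4 / (margin k q)\<^sup>2 < real C" using reals_Archimedean2 by blast
  with margin have "0 < real C" by (meson divide_pos_pos less_trans zero_less_numeral)
  hence "0 < C" by simp
  have C4: "4 \<le> real C * (margin k q)\<^sup>2"
    using C margin by (simp add: pos_divide_less_eq less_imp_le)
  have "\<exists>t s. exec f w (recovery_prog k C) (init_state n) t s \<and> t \<le> poly (time_poly k) n \<and>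
      legal_queries n (asked s) \<and> length (asked s) \<le> n * num_refs C n"
    if "f \<in> set_pmf (oracle_pmf k q n g)" for n g f w
    using recovery_prog_correct[OF assms(1) _ _ that, of w C] assms(2,3) by auto
  with excess_tendsto_0[OF \<open>0 < C\<close>] queries_bigo[of C]
    recovery_prob_tendsto[OF assms(1-3) \<open>0 < C\<close> C4, of "poly (time_poly k)"]
  show ?thesis
    by (intro exI[of _ "recovery_prog k C"] exI[of _ "time_poly k"]
      exI[of _ "\<lambda>n. n * num_refs C n"] exI[of _ "excess C"]) blast
qed

end
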